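(* Let $p$ be a prime and let $U\subseteq\mathbb F_p^2$ with $\#U=np-r$ for some integers $1\leq n\leq p$ and $0\leq r<p$. If $U$ is not contained in the union of $n$ lines, then there are at least $\left\lceil \frac{p+n+2-r}{n+1}\right\rceil$ $U$-special directions.
   Context: A line of $\mathbb F_p^2$ is either a set $\{(u,v): v=mu-k\}$ with $m,k\in\mathbb F_p$ (its slope, or direction, is $m$) or a vertical set $\{(u,v):u=c\}$ with $c\in\mathbb F_p$ (its slope is $\infty$); parallel lines have the same slope, and the $p+1$ directions are identified with $\mathbb F_p\cup\{\infty\}$. For $U\subseteq\mathbb F_p^2$ put $\theta=\#U/p$. A line $\ell$ is $U$-rich if $\#(\ell\cap U)\geq\theta+1$ and $U$-poor if $\#(\ell\cap U)\leq\theta-1$. A direction $m\in\mathbb F_p\cup\{\infty\}$ is $U$-special if there is a line with slope $m$ that is $U$-rich or $U$-poor. *)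

theory Defs
  imports Complex_Main "HOL-Library.Cardinality" "HOL-Computational_Algebra.Primes"
begin

text \<open>
  The field with \<open>p\<close> elements, \<open>p\<close> prime, is represented by a type variable \<open>'a\<close> of
  sort \<open>{field, finite}\<close> with \<open>CARD('a) = p\<close>; its affine plane is the type \<open>'a \<times> 'a\<close>.
\<close>

datatype 'a direction = Slope 'a | Vertical

fun lines_with_slope :: "'a::field direction \<Rightarrow> ('a \<times> 'a) set set" where
  "lines_with_slope (Slope m) = {{(u, v). v = m * u - k} | k. True}"
| "lines_with_slope Vertical = {{(u, v). u = c} | c. True}"

definition is_line :: "('a::field \<times> 'a) set \<Rightarrow> bool" where
  "is_line l \<longleftrightarrow> (\<exists>d. l \<in> lines_with_slope d)"

definition theta :: "('a::{field,finite} \<times> 'a) set \<Rightarrow> real" where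
  "theta U = real (card U) / real CARD('a)"

definition rich :: "('a::{field,finite} \<times> 'a) set \<Rightarrow> ('a \<times> 'a) set \<Rightarrow> bool" where
  "rich U l \<longleftrightarrow> is_line l \<and> real (card (l \<inter> U)) \<ge> theta U + 1"

definition poor :: "('a::{field,finite} \<times> 'a) set \<Rightarrow> ('a \<times> 'a) set \<Rightarrow> bool" where
  "poor U l \<longleftrightarrow> is_line l \<and> real (card (l \<inter> U)) \<le> theta U - 1"

definition special :: "('a::{field,finite} \<times> 'a) set \<Rightarrow> 'a direction \<Rightarrow> bool" where
  "special U d \<longleftrightarrow> (\<exists>l\<in>lines_with_slope d. rich U l \<or> poor U l)"

end

theory Submission
  imports Defs "HOL-Computational_Algebra.Polynomial"
begin

text \<open>
  Let \<open>E\<close> be a set of \<open>d + 1\<close> directions containing all special ones and suppose that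
  \<open>(n + 1) d + r \<le> p\<close>; in every direction outside \<open>E\<close> each line has \<open>n - 1\<close> or \<open>n\<close> points of \<open>U\<close>.
  Move one element of \<open>E\<close> to infinity and let \<open>R(X, Y)\<close> be the product of the \<open>X + a Y - b\<close> over
  \<open>(a, b) \<in> U\<close>, \<open>Z = X\<^sup>p - X\<close>, and \<open>f\<close> the quotient of \<open>Z\<^sup>n\<close> by \<open>R\<close>, of total degree at most \<open>r\<close>.
  For \<open>y\<close> outside \<open>E\<close> one has \<open>R(X, y) f(X, y) = Z\<^sup>n\<close>, and \<open>H = R f\<close> vanishes to order \<open>n\<close> at all
  points \<open>(x, y)\<close>. As there are \<open>p - d\<close> such \<open>y\<close>, this forces \<open>H(X, z) = \<Sum>a\<le>n. Z\<^sup>a c\<^sub>a(X)\<close> for every \<open>z\<close>,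
  with \<open>deg c\<^sub>a \<le> (n - a) d\<close> and \<open>c\<^sub>n = 1\<close>. Since \<open>R(X, z)\<close> splits into linear factors over the
  field, it divides both \<open>H\<close> and \<open>Z H'\<close>; eliminating \<open>Z\<^sup>n\<close> leaves a polynomial of too small a degree,
  hence \<open>Z H' = - k H\<close> and \<open>H = Z\<^sup>k H\<^sub>1\<close> with \<open>H\<^sub>1' = 0\<close> for some \<open>k \<le> n\<close>. Therefore a line with more than \<open>n\<close> points
  corresponds to a root of \<open>H\<close> of multiplicity at least \<open>p\<close>, and has at least \<open>p - r > n d\<close> points.
  Counting through a point of \<open>U\<close> shows that such lines exist if \<open>d \<ge> 1\<close>.

  If a line with more than \<open>n d\<close> points misses a point \<open>(a, b)\<close>, then counting the lines through it shows that
  \<open>f(b - a Y, Y)\<close> has more than \<open>r\<close> zeros, so it vanishes identically and \<open>(a, b)\<close> may be added to \<open>U\<close>,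
  with \<open>r\<close> replaced by \<open>r - 1\<close>. If the line is full, it may be removed, with \<open>n\<close>
  replaced by \<open>n - 1\<close>. By induction \<open>U\<close> is covered by \<open>n\<close> lines.
\<close>

section \<open>Split polynomials over a finite field\<close>

text \<open>The polynomial Z of the overview, given in split form so that multiplicities and
  divisibility by linear factors can be read off; \<open>vanishing_poly_eq\<close> recovers the
  two-term form.\<close>

definition vanishing_poly :: "'a::{field,finite} poly" where
  "vanishing_poly = (\<Prod>x\<in>UNIV. [:- x, 1:])"

text \<open>Multiplication by a nonzero x permutes the nonzero elements, so it leaves their product
  unchanged.\<close>

lemma finite_field_power_card: "(x::'a::{field,finite}) ^ CARD('a) = x"
proof (cases "x = 0")
  case False
  have bij: "bij_betw ((*) x) (UNIV - {0}) (UNIV - {0})"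
    by (rule bij_betw_byWitness[where f' = "\<lambda>y. y / x"]) (use False in auto)
  have "(\<Prod>y\<in>UNIV - {0}. y) = (\<Prod>y\<in>UNIV - {0}. x * y)"
    using prod.reindex_bij_betw[OF bij, of "\<lambda>y. y"] by simp
  also have "\<dots> = x ^ (CARD('a) - 1) * (\<Prod>y\<in>UNIV - {0}. y)"
    by (simp add: prod.distrib)
  finally have "x ^ (CARD('a) - 1) = 1" by simp
  then have "x * x ^ (CARD('a) - 1) = x" by simp
  then show ?thesis by (metis power_Suc Suc_diff_1 zero_less_card_finite)
qed auto

text \<open>Translation by 1 permutes the field, so it leaves the sum of all elements
  unchanged.\<close>

lemma of_nat_card_eq_0: "of_nat CARD('a) = (0::'a::{field,finite})"
proof -
  have "bij (\<lambda>x::'a. x + 1)" by (rule bij_plus_right)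
  from sum.reindex_bij_betw[OF this, of "\<lambda>x. x"] show ?thesis by (simp add: sum.distrib)
qed

lemma degree_prod_linear:
  "degree (\<Prod>u\<in>A. [:- g u, 1:] :: 'a::idom poly) = card A"
  by (simp add: degree_prod_eq_sum_degree)

lemma lead_coeff_prod_linear:
  "lead_coeff (\<Prod>u\<in>A. [:- g u, 1:] :: 'a::idom poly) = 1"
  by (simp add: lead_coeff_prod)

lemma prod_linear_nonzero: "(\<Prod>u\<in>A. [:- g u, 1:] :: 'a::idom poly) \<noteq> 0"
  by (cases "finite A") auto

lemma order_prod_linear:
  assumes "finite A"
  shows "order x (\<Prod>u\<in>A. [:- g u, 1:] :: 'a::idom poly) = card {u\<in>A. g u = x}"
  using assms
proof (induction A rule: finite_induct)
  case (insert v A)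
  have "order x ([:- g v, 1:] * (\<Prod>u\<in>A. [:- g u, 1:])) =
    order x [:- g v, 1:] + order x (\<Prod>u\<in>A. [:- g u, 1:])"
    by (intro order_mult no_zero_divisors prod_linear_nonzero) simp
  moreover have "order x [:- g v, 1:] = (if g v = x then 1 else 0)"
    using order_power_n_n[of x 1] by (auto intro: order_0I)
  moreover have "{u \<in> insert v A. g u = x} =
      (if g v = x then insert v {u\<in>A. g u = x} else {u\<in>A. g u = x})" by auto
  ultimately show ?case using insert by simp
qed auto

lemma prod_linear_dvd_power:
  assumes "finite A" and "\<And>x. card {u\<in>A. g u = x} \<le> n"
  shows "(\<Prod>u\<in>A. [:- g u, 1:]) dvd (vanishing_poly :: 'a::{field,finite} poly) ^ n"
proof -
  have "(\<Prod>u\<in>A. [:- g u, 1:]) = (\<Prod>x\<in>UNIV. \<Prod>u\<in>{u\<in>A. g u = x}. [:- g u, 1:])"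
    by (rule prod.group[symmetric]) (use assms in auto)
  also have "\<dots> = (\<Prod>x\<in>UNIV. [:- x, 1:] ^ card {u\<in>A. g u = x})"
    by (intro prod.cong refl) simp
  also have "\<dots> dvd (\<Prod>x\<in>UNIV. [:- x, 1:] ^ n)"
    by (intro prod_dvd_prod le_imp_power_dvd assms)
  finally show ?thesis by (simp add: vanishing_poly_def prod_power_distrib)
qed

text \<open>Distinct linear factors are coprime: once the factors for A are split off, the order at
  a new v sits entirely in the cofactor.\<close>

lemma prod_linear_powers_dvd:
  fixes q :: "'a::idom poly"
  assumes "finite A" and "\<And>x. x \<in> A \<Longrightarrow> [:- x, 1:] ^ n dvd q"
  shows "(\<Prod>x\<in>A. [:- x, 1:]) ^ n dvd q"
  using assms
proof (induction A rule: finite_induct)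
  case (insert v A)
  then obtain s where s: "q = (\<Prod>x\<in>A. [:- x, 1:]) ^ n * s" by (metis dvdE insertCI)
  show ?case
  proof (cases "q = 0")
    case False
    have "order v ((\<Prod>x\<in>A. [:- x, 1:]) ^ n) = 0"
      using insert.hyps by (intro order_0I) (auto simp: poly_prod)
    then have "order v q = order v s" using False s by (simp add: order_mult)
    moreover have "n \<le> order v q" using insert.prems[of v] False by (simp add: order_divides)
    ultimately have "[:- v, 1:] ^ n dvd s" by (simp add: order_divides)
    then have "[:- v, 1:] ^ n * (\<Prod>x\<in>A. [:- x, 1:]) ^ n dvd s * (\<Prod>x\<in>A. [:- x, 1:]) ^ n"
      by (intro mult_dvd_mono) auto
    then show ?thesis
      using s by (simp only: prod.insert[OF insert.hyps] power_mult_distrib mult.commute[of _ s])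
  qed auto
qed auto

lemma vanishing_poly_nonzero: "vanishing_poly \<noteq> 0"
  unfolding vanishing_poly_def by (rule prod_linear_nonzero[of "\<lambda>x. x"])

lemma degree_vanishing_poly: "degree (vanishing_poly :: 'a::{field,finite} poly) = CARD('a)"
  unfolding vanishing_poly_def by (rule degree_prod_linear)

lemma linear_dvd_vanishing_poly: "[:- x, 1:] dvd vanishing_poly"
  unfolding vanishing_poly_def by (rule dvd_prodI) auto

lemma order_vanishing_poly_power: "order (x::'a::{field,finite}) (vanishing_poly ^ n) = n"
proof (induction n)
  case (Suc n)
  have "order x vanishing_poly = 1"
    unfolding vanishing_poly_def by (subst order_prod_linear) auto
  moreover have "order x (vanishing_poly ^ Suc n) = order x vanishing_poly + order x (vanishing_poly ^ n)"
    using vanishing_poly_nonzero[where 'a = 'a] unfolding power_Suc by (intro order_mult) simp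
  ultimately show ?case using Suc by simp
qed auto

text \<open>Both sides are monic of the same degree and vanish on the whole field; a nonzero
  difference would have more roots than its degree allows.\<close>

lemma vanishing_poly_eq:
  "(vanishing_poly :: 'a::{field,finite} poly) = monom 1 CARD('a) - monom 1 1"
proof (rule ccontr)
  let ?Z = "vanishing_poly :: 'a poly" and ?p = "CARD('a)"
  let ?D = "?Z - (monom 1 ?p - monom 1 1)"
  assume "?Z \<noteq> monom 1 ?p - monom 1 1"
  then have D: "?D \<noteq> 0" by simp
  have p: "1 < ?p"
    using card_mono[of UNIV "{0, 1 :: 'a}"] by simp
  have "coeff ?Z ?p = 1"
    using lead_coeff_prod_linear[of "\<lambda>x. x" "UNIV :: 'a set"] degree_vanishing_poly[where 'a = 'a]
    by (simp add: vanishing_poly_def)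
  then have "coeff ?D i = 0" if "i \<ge> ?p" for i
    using that p degree_vanishing_poly[where 'a = 'a] by (cases "i = ?p") (auto simp: coeff_eq_0)
  then have "degree ?D < ?p" using D by (metis leading_coeff_0_iff not_less)
  moreover have "poly ?D x = 0" for x
    using linear_dvd_vanishing_poly[of x] by (simp add: poly_eq_0_iff_dvd poly_monom finite_field_power_card)
  ultimately show False using card_poly_roots_bound[OF D] by simp
qed

lemma pderiv_vanishing_poly: "pderiv (vanishing_poly :: 'a::{field,finite} poly) = - 1"
proof -
  show ?thesis by (simp add: vanishing_poly_eq pderiv_diff pderiv_monom of_nat_card_eq_0)
qed

text \<open>Each summand of the derivative lacks one linear factor, and Z supplies it. Repeated
  roots are allowed.\<close>

lemma prod_linear_dvd_pderiv:
  fixes g :: "'b \<Rightarrow> 'a::{field,finite}"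
  assumes "finite A"
  shows "(\<Prod>u\<in>A. [:- g u, 1:]) dvd vanishing_poly * pderiv (\<Prod>u\<in>A. [:- g u, 1:])"
  using assms
proof (induction A rule: finite_induct)
  case (insert v A)
  let ?L = "[:- g v, 1:]" and ?P = "\<Prod>u\<in>A. [:- g u, 1:]"
  have "pderiv ?L = 1" by (simp add: pderiv_pCons)
  then have "vanishing_poly * pderiv (?L * ?P) = ?L * (vanishing_poly * pderiv ?P) + vanishing_poly * ?P"
    by (simp only: pderiv_mult) (simp add: algebra_simps)
  moreover have "?L * ?P dvd ?L * (vanishing_poly * pderiv ?P)" using insert by (intro mult_dvd_mono) auto
  moreover have "?L * ?P dvd vanishing_poly * ?P" by (intro mult_dvd_mono linear_dvd_vanishing_poly dvd_refl)
  ultimately show ?case unfolding prod.insert[OF insert.hyps] by (simp only: dvd_add)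
qed auto

text \<open>A root of order m + 1 < p would have order exactly m in the derivative, because m + 1 is
  invertible in the field.\<close>

lemma pderiv_zero_imp_order_ge:
  fixes q :: "'a::{field,finite} poly"
  assumes "prime CARD('a)" and "pderiv q = 0" and "q \<noteq> 0" and "poly q x = 0"
  shows "CARD('a) \<le> order x q"
proof (rule ccontr)
  assume less: "\<not> CARD('a) \<le> order x q"
  define m where "m = order x q - 1"
  have pos: "order x q = Suc m" using assms by (simp add: m_def order_gt_0_iff)
  have "CHAR('a) = CARD('a)"
    using assms(1) of_nat_card_eq_0[where 'a='a]
    by (metis CHAR_not_1 One_nat_def of_nat_eq_0_iff_char_dvd prime_nat_iff)
  then have nz: "of_nat (Suc m) \<noteq> (0::'a)"
    using less pos unfolding of_nat_eq_0_iff_char_dvd by (auto dest: dvd_imp_le)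
  obtain s where s: "q = [:- x, 1:] ^ Suc m * s" "\<not> [:- x, 1:] dvd s"
    using order_decomp[OF assms(3), of x] pos by auto
  have "pderiv q = [:- x, 1:] ^ m * (smult (of_nat (Suc m)) s + [:- x, 1:] * pderiv s)"
    unfolding s(1) pderiv_mult pderiv_power_Suc
    by (simp add: pderiv_pCons algebra_simps)
  then have "smult (of_nat (Suc m)) s = [:- x, 1:] * (- pderiv s)"
    using assms(2) by (simp only: mult_minus_right eq_neg_iff_add_eq_0) simp
  then have "[:- x, 1:] dvd smult (of_nat (Suc m)) s" by (metis dvd_triv_left)
  then have "[:- x, 1:] dvd s" using nz by (rule dvd_smult_cancel)
  then show False using s by simp
qed

section \<open>Lacunary polynomials with a split factor\<close>

text \<open>As Z' = -1, the operator taking q to Z q' preserves multiples of Z^a. This is what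
  allows Z H' to be compared with H power by power.\<close>

lemma pderiv_vanishing_power_mult:
  "vanishing_poly * pderiv (vanishing_poly ^ a * c) =
    vanishing_poly ^ a * (vanishing_poly * pderiv c - of_nat a * c)"
proof (cases a)
  case (Suc b)
  have "pderiv (vanishing_poly ^ Suc b) = - (of_nat (Suc b) * vanishing_poly ^ b :: 'a poly)"
    unfolding pderiv_power_Suc pderiv_vanishing_poly
    by (simp add: of_nat_poly algebra_simps)
  then show ?thesis unfolding Suc pderiv_mult by (simp del: power_Suc) (simp add: algebra_simps)
qed simp

lemma degree_pderiv_le: "degree (pderiv q) \<le> degree q - 1"
  by (intro degree_le) (auto simp: coeff_pderiv coeff_eq_0)

lemma pderiv_sum: "pderiv (sum f A) = (\<Sum>a\<in>A. pderiv (f a))"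
  using higher_pderiv_sum[of 1 f A] by simp

lemma vanishing_poly_dvd_imp_zero:
  assumes "(vanishing_poly :: 'a::{field,finite} poly) dvd q" and "degree q < CARD('a)"
  shows "q = 0"
  using assms by (metis dvd_imp_degree_le degree_vanishing_poly leD)

text \<open>H is a multiple of the split polynomial R and also a combination of powers of Z with
  coefficients of low degree. The first fact makes R divide H and Z H'; the second makes a
  combination of these too small in degree to be a nonzero multiple of R. The resulting differential
  equation controls the multiplicities of the roots.\<close>

lemma order_ge_of_lacunary:
  fixes g :: "'b \<Rightarrow> 'a::{field,finite}" and f :: "'a poly"
  assumes prime: "prime CARD('a)" and n: "1 \<le> n" and d: "1 \<le> d"
    and bound: "(n + 1) * d + r \<le> CARD('a)"
    and fin: "finite U" and card: "card U + r = n * CARD('a)" and f: "degree f \<le> r"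
    and H: "(\<Prod>u\<in>U. [:- g u, 1:]) * f = (\<Sum>a\<le>n. vanishing_poly ^ a * c a)"
    and cn: "c n = 1" and deg: "\<And>a. a \<le> n \<Longrightarrow> degree (c a) \<le> (n - a) * d"
    and rich: "n < card {u\<in>U. g u = x}"
  shows "CARD('a) \<le> card {u\<in>U. g u = x} + r"
proof -
  let ?p = "CARD('a)"
  define Z where "Z = (vanishing_poly :: 'a poly)"
  define R where "R = (\<Prod>u\<in>U. [:- g u, 1:])"
  define H where "H = (\<Sum>a\<le>n. Z ^ a * c a)"
  have RH: "R * f = H" using H by (simp add: R_def H_def Z_def)
  have Z: "Z \<noteq> 0" "degree Z = ?p"
    by (simp_all add: Z_def vanishing_poly_nonzero degree_vanishing_poly)
  obtain n' where n': "n = Suc n'" using n by (cases n) auto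
  \<comment> \<open>Since \<open>c n = 1\<close>, the terms of Z H' that carry Z^n add up to Z^n
    e.\<close>
  define e where "e = pderiv (c n') - of_nat n"
  have e: "degree e \<le> d - 1"
  proof -
    have "degree (pderiv (c n')) \<le> d - 1"
      using deg[of n'] degree_pderiv_le[of "c n'"] by (simp add: n')
    then show ?thesis unfolding e_def by (intro degree_diff_le) auto
  qed
  have ae: "degree (of_nat a + e) \<le> d - 1" for a
    using e by (intro degree_add_le) auto

  txt \<open>Subtracting \<open>e H\<close> cancels the \<open>Z\<^sup>n\<close> term of \<open>Z H'\<close>.\<close>
  define W where "W = Z * pderiv H - e * H"
  have "R dvd Z * pderiv H"
  proof -
    have "Z * pderiv H = R * (Z * pderiv f) + f * (Z * pderiv R)"
      unfolding RH[symmetric] pderiv_mult by (simp add: algebra_simps)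
    moreover have "R dvd Z * pderiv R"
      unfolding R_def Z_def using fin by (rule prod_linear_dvd_pderiv)
    ultimately show ?thesis by simp
  qed
  then have "R dvd W" unfolding W_def RH[symmetric] by (intro dvd_diff) auto
  have "W = (\<Sum>a\<le>n. Z ^ a * (Z * pderiv (c a) - of_nat a * c a) - e * (Z ^ a * c a))"
    unfolding W_def H_def pderiv_sum sum_distrib_left sum_subtractf[symmetric]
    by (simp add: Z_def pderiv_vanishing_power_mult)
  also have "\<dots> = (\<Sum>a\<le>n. Z ^ Suc a * pderiv (c a) - Z ^ a * ((of_nat a + e) * c a))"
    by (intro sum.cong refl) (simp add: algebra_simps)
  also have "\<dots> = (\<Sum>a<n'. Z ^ Suc a * pderiv (c a)) - (\<Sum>a\<le>n'. Z ^ a * ((of_nat a + e) * c a))"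
  proof -
    have "(\<Sum>a\<le>n. Z ^ Suc a * pderiv (c a)) = (\<Sum>a<n'. Z ^ Suc a * pderiv (c a)) + Z ^ n * pderiv (c n')"
      using cn by (simp add: n' lessThan_Suc_atMost[symmetric])
    moreover have "(\<Sum>a\<le>n. Z ^ a * ((of_nat a + e) * c a)) =
        (\<Sum>a\<le>n'. Z ^ a * ((of_nat a + e) * c a)) + Z ^ n * pderiv (c n')"
      using cn by (simp add: n' e_def)
    ultimately show ?thesis by (simp add: sum_subtractf)
  qed
  finally have W: "W = \<dots>" .
  have deg_mult: "degree (Z ^ a * q) \<le> a * ?p + D" if "degree q \<le> D" for a q D
    using that Z by (metis add_mono degree_mult_le degree_power_le le_trans mult.commute)
  \<comment> \<open>No power of Z beyond Z^(n-1) is left, and its cofactors have degree at most (n +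
    1) d - 1 < p - r, so the degree stays below n p - r = \<open>card U\<close>.\<close>
  have "degree W \<le> card U - 1"
    unfolding W
  proof (intro degree_diff_le degree_sum_le)
    fix a assume a: "a \<in> {..<n'}"
    have "degree (pderiv (c a)) \<le> (n - a) * d - 1"
      using degree_pderiv_le[of "c a"] deg[of a] a by (simp add: n')
    then have "degree (Z ^ Suc a * pderiv (c a)) \<le> Suc a * ?p + ((n - a) * d - 1)" by (rule deg_mult)
    also have "\<dots> \<le> card U - 1"
    proof -
      have "(n - a) * d \<le> (n + 1) * d" by (intro mult_right_mono) auto
      moreover have "0 < (n - a) * d" using a d by (simp add: n')
      moreover have "(a + 2) * ?p \<le> n * ?p" using a by (intro mult_right_mono) (auto simp: n')
      moreover have "(a + 2) * ?p = Suc a * ?p + ?p" by simp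
      ultimately show ?thesis using bound card by linarith
    qed
    finally show "degree (Z ^ Suc a * pderiv (c a)) \<le> card U - 1" .
  next
    fix a assume a: "a \<in> {..n'}"
    have "degree ((of_nat a + e) * c a) \<le> (d - 1) + (n - a) * d"
      using degree_mult_le[of "of_nat a + e" "c a"] ae[of a] deg[of a] a by (simp add: n')
    then have "degree (Z ^ a * ((of_nat a + e) * c a)) \<le> a * ?p + ((d - 1) + (n - a) * d)" by (rule deg_mult)
    also have "\<dots> \<le> card U - 1"
    proof -
      have "(n - a) * d \<le> n * d" by (intro mult_right_mono) auto
      moreover have "(n + 1) * d = n * d + d" by simp
      moreover have "(a + 1) * ?p \<le> n * ?p" using a by (intro mult_right_mono) (auto simp: n')
      moreover have "(a + 1) * ?p = a * ?p + ?p" by simp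
      ultimately show ?thesis using bound card d by linarith
    qed
    finally show "degree (Z ^ a * ((of_nat a + e) * c a)) \<le> card U - 1" .
  qed auto
  moreover have "0 < card U"
  proof -
    have "?p \<le> n * ?p" using n by simp
    moreover have "0 < (n + 1) * d" using d by simp
    ultimately show ?thesis using bound card by linarith
  qed
  moreover have "degree R = card U" unfolding R_def by (rule degree_prod_linear)
  ultimately have "W = 0" using \<open>R dvd W\<close> by (metis Suc_pred' dvd_imp_degree_le not_less_eq_eq)
  then have ode: "Z * pderiv H = e * H" by (simp add: W_def)

  \<comment> \<open>Z^k is the lowest power of Z occurring in H. It is the exact power dividing H,
    as \<open>c k\<close> is nonzero of degree below p.\<close>
  define k where "k = (LEAST k. c k \<noteq> 0)"
  have ck: "c k \<noteq> 0" unfolding k_def by (rule LeastI[of _ n]) (simp add: cn)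
  have kn: "k \<le> n" unfolding k_def by (rule Least_le) (simp add: cn)
  have below: "c a = 0" if "a < k" for a using not_less_Least that unfolding k_def by blast
  define H1 where "H1 = (\<Sum>i\<le>n - k. Z ^ i * c (k + i))"
  have "H = (\<Sum>a\<in>{k..n}. Z ^ a * c a)"
    unfolding H_def by (rule sum.mono_neutral_right) (auto simp: below)
  also have "\<dots> = (\<Sum>i\<le>n - k. Z ^ (k + i) * c (k + i))"
    by (rule sum.reindex_bij_witness[of _ "\<lambda>i. k + i" "\<lambda>a. a - k"]) (use kn in auto)
  finally have HH1: "H = Z ^ k * H1" by (simp add: H1_def sum_distrib_left power_add mult.assoc)
  define B where "B = (\<Sum>i<n - k. Z ^ i * c (k + Suc i))"
  have H1B: "H1 = c k + Z * B"
    unfolding H1_def B_def by (subst sum.atMost_shift) (simp add: sum_distrib_left mult.assoc)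
  have degck: "degree (c k) \<le> n * d"
    using deg[OF kn] by (meson diff_le_self le_trans mult_le_mono1)
  have H1nz: "H1 \<noteq> 0"
  proof
    assume "H1 = 0"
    then have "c k = Z * (- B)" unfolding H1B by (simp add: eq_neg_iff_add_eq_0)
    moreover have "degree (c k) < ?p" using degck bound d by auto
    ultimately show False using ck vanishing_poly_dvd_imp_zero by (metis Z_def dvd_triv_left)
  qed
  have "Z ^ k * (Z * pderiv H1) = Z ^ k * ((of_nat k + e) * H1)"
    using ode pderiv_vanishing_power_mult[of k H1]
    unfolding HH1 by (simp add: Z_def algebra_simps)
  then have red: "Z * pderiv H1 = (of_nat k + e) * H1" using Z by simp
  \<comment> \<open>Reduction of \<open>red\<close> modulo Z: H1 is congruent to \<open>c k\<close>,
    and (k + e) \<open>c k\<close> has degree at most (d - 1) + n d < p, so it can be divisible by Z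
    only if it is zero.\<close>
  have "of_nat k + e = 0"
  proof -
    have "(of_nat k + e) * c k = Z * (pderiv H1 - (of_nat k + e) * B)"
      using red unfolding H1B by (simp add: algebra_simps)
    moreover have "degree ((of_nat k + e) * c k) < ?p"
    proof -
      have "degree ((of_nat k + e) * c k) \<le> (d - 1) + n * d"
        using degree_mult_le[of "of_nat k + e" "c k"] ae[of k] degck by linarith
      then show ?thesis using bound d by simp
    qed
    ultimately have "(of_nat k + e) * c k = 0"
      using vanishing_poly_dvd_imp_zero by (metis Z_def dvd_triv_left)
    then show ?thesis using ck by simp
  qed
  then have der: "pderiv H1 = 0" using red Z by simp

  have Hnz: "H \<noteq> 0" using HH1 H1nz Z by simp
  have "order x H = order x R + order x f" using Hnz RH by (metis order_mult)
  moreover have "order x H = k + order x H1"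
    using Hnz order_mult[of "Z ^ k" H1 x] HH1 order_vanishing_poly_power[of x k] by (simp add: Z_def)
  moreover have "order x R = card {u\<in>U. g u = x}" unfolding R_def using fin by (rule order_prod_linear)
  moreover have "order x f \<le> r"
    using f Hnz RH order_degree[of f x] by force
  \<comment> \<open>The order of x in H exceeds n \<ge> k, so Z^k cannot account for it and x is a
    root of H1.\<close>
  moreover have "?p \<le> order x H1"
    using prime der H1nz
  proof (rule pderiv_zero_imp_order_ge)
    have "0 < order x H1" using calculation kn rich by linarith
    then show "poly H1 x = 0" using H1nz by (simp add: order_gt_0_iff)
  qed
  ultimately show ?thesis by linarith
qed

section \<open>Bivariate polynomials\<close>

text \<open>
  Polynomials in \<open>X\<close> and \<open>Y\<close> have type \<^typ>\<open>'a poly poly\<close>; the outer variable is \<open>X\<close>.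
\<close>

definition total_degree_le :: "nat \<Rightarrow> 'a::zero poly poly \<Rightarrow> bool" where
  "total_degree_le M G \<longleftrightarrow> (\<forall>i. coeff G i \<noteq> 0 \<longrightarrow> degree (coeff G i) + i \<le> M)"

lemma total_degree_le_0: "total_degree_le M 0"
  by (simp add: total_degree_le_def)

lemma total_degree_le_add:
  assumes "total_degree_le M G" and "total_degree_le M H"
  shows "total_degree_le M (G + H)"
  unfolding total_degree_le_def
proof (intro allI impI)
  fix i assume nz: "coeff (G + H) i \<noteq> 0"
  have *: "degree (coeff F i) \<le> M - i" if "total_degree_le M F" for F :: "'a poly poly"
    using that by (cases "coeff F i = 0") (auto simp: total_degree_le_def le_diff_conv2)
  have "i \<le> M" using nz assms unfolding total_degree_le_def coeff_add
    by (metis add.right_neutral add_leD2)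
  then show "degree (coeff (G + H) i) + i \<le> M"
    using degree_add_le[OF *[OF assms(1)] *[OF assms(2)]] by simp
qed

lemma total_degree_le_uminus:
  "total_degree_le M (G :: 'a::ab_group_add poly poly) \<Longrightarrow> total_degree_le M (- G)"
  by (simp add: total_degree_le_def)

lemma total_degree_le_diff:
  "total_degree_le M (G :: 'a::ab_group_add poly poly) \<Longrightarrow> total_degree_le M H \<Longrightarrow> total_degree_le M (G - H)"
  using total_degree_le_add[of M G "- H"] total_degree_le_uminus[of M H] by simp

lemma total_degree_le_sum:
  assumes "\<And>i. i \<in> A \<Longrightarrow> total_degree_le M (F i)"
  shows "total_degree_le M (sum F A)"
  using assms by (induction A rule: infinite_finite_induct) (auto intro: total_degree_le_0 total_degree_le_add)

lemma total_degree_le_monom: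
  "degree c + i \<le> M \<Longrightarrow> total_degree_le M (monom c i)"
  by (auto simp: total_degree_le_def)

lemma total_degree_le_mult:
  fixes G H :: "'a::comm_semiring_0 poly poly"
  assumes "total_degree_le M G" and "total_degree_le N H"
  shows "total_degree_le (M + N) (G * H)"
proof -
  have "G * H = (\<Sum>i\<le>degree G. \<Sum>j\<le>degree H. monom (coeff G i) i * monom (coeff H j) j)"
    unfolding sum_product[symmetric] poly_as_sum_of_monoms ..
  also have "total_degree_le (M + N) \<dots>"
  proof (intro total_degree_le_sum)
    fix i j
    show "total_degree_le (M + N) (monom (coeff G i) i * monom (coeff H j) j)"
    proof (cases "coeff G i = 0 \<or> coeff H j = 0")
      case False
      then have "degree (coeff G i) + i \<le> M" "degree (coeff H j) + j \<le> N"
        using assms by (auto simp: total_degree_le_def)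
      then show ?thesis
        unfolding mult_monom using degree_mult_le[of "coeff G i" "coeff H j"]
        by (intro total_degree_le_monom) linarith
    qed (auto simp: total_degree_le_0)
  qed
  finally show ?thesis .
qed

lemma total_degree_le_prod:
  fixes F :: "'b \<Rightarrow> 'a::comm_semiring_1 poly poly"
  assumes "\<And>u. u \<in> A \<Longrightarrow> total_degree_le 1 (F u)"
  shows "total_degree_le (card A) (prod F A)"
  using assms
proof (induction A rule: infinite_finite_induct)
  case (insert u A)
  then show ?case using total_degree_le_mult[of 1 "F u" "card A" "prod F A"] by simp
qed (auto simp: total_degree_le_def)

text \<open>Ordinary division in X by a monic R. Each step subtracts R times a monomial of total
  degree at most M - D, so no total degree grows.\<close>

lemma total_degree_le_monic_division:
  fixes R G :: "'a::comm_ring_1 poly poly"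
  assumes R: "degree R = D" "lead_coeff R = 1" "total_degree_le D R"
    and G: "total_degree_le M G" and "D \<le> M"
  obtains q s where "G = R * q + s" "total_degree_le (M - D) q" "total_degree_le M s"
    "\<And>i. D \<le> i \<Longrightarrow> coeff s i = 0"
proof -
  \<comment> \<open>Induction on a strict bound e for the X-degree of G.\<close>
  have "\<exists>q s. G = R * q + s \<and> total_degree_le (M - D) q \<and> total_degree_le M s \<and> (\<forall>i\<ge>D. coeff s i = 0)"
    if "\<forall>i\<ge>e. coeff G i = 0" for e
    using G that
  proof (induction e arbitrary: G)
    case 0
    then have "G = 0" by (auto intro: poly_eqI)
    then show ?case by (intro exI[of _ 0]) (auto simp: total_degree_le_0)
  next
    case (Suc e)
    show ?case
    proof (cases "e < D")
      case True
      then show ?thesis using Suc.prems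
        by (intro exI[of _ 0] exI[of _ G]) (auto simp: total_degree_le_0)
    next
      case False
      define m where "m = monom (coeff G e) (e - D)"
      have m: "total_degree_le (M - D) m"
      proof (cases "coeff G e = 0")
        case nz: False
        then have "degree (coeff G e) + e \<le> M" using Suc.prems by (simp add: total_degree_le_def)
        then show ?thesis unfolding m_def using False by (intro total_degree_le_monom) linarith
      qed (simp add: m_def total_degree_le_0)
      have Rm: "total_degree_le M (R * m)"
        using total_degree_le_mult[OF R(3) m] \<open>D \<le> M\<close> by simp
      have "\<forall>i\<ge>e. coeff (G - R * m) i = 0"
      proof (intro allI impI)
        fix i assume i: "e \<le> i"
        have c: "coeff (R * m) i = coeff R (i - (e - D)) * coeff G e"
          using i coeff_monom_mult[of "coeff G e" "e - D" R i] unfolding m_def mult.commute[of R]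
          by (simp add: mult.commute)
        show "coeff (G - R * m) i = 0"
        proof (cases "i = e")
          case True
          then show ?thesis using c R(1,2) False by simp
        next
          case ne: False
          then have "D < i - (e - D)" using i False by simp
          then have "coeff R (i - (e - D)) = 0" using R(1) by (simp add: coeff_eq_0)
          then show ?thesis using c Suc.prems i ne by simp
        qed
      qed
      with Suc.IH[of "G - R * m"] Suc.prems Rm
      obtain q s where "G - R * m = R * q + s" "total_degree_le (M - D) q" "total_degree_le M s"
        "\<forall>i\<ge>D. coeff s i = 0" using total_degree_le_diff by blast
      then show ?thesis using m
        by (intro exI[of _ "q + m"] exI[of _ s]) (auto simp: algebra_simps intro: total_degree_le_add)
    qed
  qed
  from this[of "Suc (degree G)"] that show ?thesis by (auto simp: coeff_eq_0)
qed

lemma degree_poly_total_degree_le: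
  fixes G :: "'a::comm_ring_1 poly poly"
  assumes "total_degree_le M G" and "degree l \<le> 1"
  shows "degree (poly G l) \<le> M"
  unfolding poly_altdef
proof (intro degree_sum_le)
  fix i
  show "degree (coeff G i * l ^ i) \<le> M"
  proof (cases "coeff G i = 0")
    case False
    have "degree (l ^ i) \<le> i" using degree_power_le[of l i] assms(2) by (metis mult_le_mono1 nat_mult_1 le_trans)
    moreover have "degree (coeff G i) + i \<le> M" using False assms(1) by (simp add: total_degree_le_def)
    ultimately show ?thesis using degree_mult_le[of "coeff G i" "l ^ i"] by linarith
  qed simp
qed auto

section \<open>Taylor coefficients in Y and orders of vanishing\<close>

text \<open>The coefficient of \<open>(Y - y)\<^sup>j\<close>, as a polynomial in \<open>X\<close>.\<close>

definition taylor_coeff :: "'a::comm_ring_1 \<Rightarrow> nat \<Rightarrow> 'a poly poly \<Rightarrow> 'a poly" where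
  "taylor_coeff y j H = map_poly (\<lambda>c. coeff (pcompose c [:y, 1:]) j) H"

lemma coeff_taylor_coeff: "coeff (taylor_coeff y j H) i = coeff (pcompose (coeff H i) [:y, 1:]) j"
  by (simp add: taylor_coeff_def coeff_map_poly)

lemma taylor_coeff_add: "taylor_coeff y j (G + H) = taylor_coeff y j G + taylor_coeff y j H"
  by (rule poly_eqI) (simp add: coeff_taylor_coeff pcompose_add)

lemma taylor_coeff_mult:
  "taylor_coeff y j (G * H) = (\<Sum>i\<le>j. taylor_coeff y i G * taylor_coeff y (j - i) H)"
proof (rule poly_eqI)
  fix m
  have "coeff (taylor_coeff y j (G * H)) m =
      (\<Sum>l\<le>m. \<Sum>i\<le>j. coeff (pcompose (coeff G l) [:y, 1:]) i * coeff (pcompose (coeff H (m - l)) [:y, 1:]) (j - i))"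
    by (simp add: coeff_taylor_coeff coeff_mult pcompose_sum pcompose_mult coeff_sum)
  also have "\<dots> = (\<Sum>i\<le>j. \<Sum>l\<le>m. coeff (pcompose (coeff G l) [:y, 1:]) i * coeff (pcompose (coeff H (m - l)) [:y, 1:]) (j - i))"
    by (rule sum.swap)
  also have "\<dots> = coeff (\<Sum>i\<le>j. taylor_coeff y i G * taylor_coeff y (j - i) H) m"
    by (simp add: coeff_sum coeff_mult coeff_taylor_coeff)
  finally show "coeff (taylor_coeff y j (G * H)) m = \<dots>" .
qed

text \<open>Substitution of y for Y, taken as the zeroth Taylor coefficient so that the product rule
  covers it.\<close>

abbreviation specialize :: "'a::comm_ring_1 \<Rightarrow> 'a poly poly \<Rightarrow> 'a poly" where
  "specialize y \<equiv> taylor_coeff y 0"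

lemma coeff_specialize: "coeff (specialize y H) i = poly (coeff H i) y"
  by (simp add: coeff_taylor_coeff)

lemma specialize_1: "specialize y 1 = 1"
  by (rule poly_eqI) (simp add: coeff_specialize coeff_1)

lemma specialize_mult: "specialize y (G * H) = specialize y G * specialize y H"
  by (simp add: taylor_coeff_mult)

lemma specialize_prod: "specialize y (prod F A) = (\<Prod>u\<in>A. specialize y (F u))"
  by (induction A rule: infinite_finite_induct) (simp_all add: specialize_1 specialize_mult)

lemma poly_specialize: "poly (specialize y G) (poly l y) = poly (poly G l) y"
proof (induction G)
  case (pCons a G)
  have "specialize y (pCons a G) = pCons (poly a y) (specialize y G)"
    by (rule poly_eqI) (simp add: coeff_specialize coeff_pCons split: nat.split)
  then show ?case using pCons by simp
qed (simp add: taylor_coeff_def)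

text \<open>The shift by y turns powers of Y - y into powers of Y, and the opposite shift turns the
  factorization back.\<close>

lemma coeff_shift_zero_imp_dvd:
  fixes q :: "'a::idom poly"
  assumes "\<And>j. j < n \<Longrightarrow> coeff (pcompose q [:y, 1:]) j = 0"
  shows "[:- y, 1:] ^ n dvd q"
proof -
  have "monom 1 n dvd pcompose q [:y, 1:]" using assms by (simp add: monom_1_dvd_iff')
  then obtain s where "pcompose q [:y, 1:] = monom 1 n * s" by (rule dvdE)
  then have "pcompose (pcompose q [:y, 1:]) [:- y, 1:] = pcompose (monom 1 n) [:- y, 1:] * pcompose s [:- y, 1:]"
    by (simp add: pcompose_mult)
  moreover have "pcompose (pcompose q [:y, 1:]) [:- y, 1:] = q"
    by (simp add: pcompose_assoc[symmetric] pcompose_pCons)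
  moreover have "pcompose (monom 1 n) [:- y, 1:] = [:- y, 1:] ^ n"
    by (induction n) (simp_all add: monom_0 monom_Suc pcompose_pCons)
  ultimately show ?thesis by simp
qed

text \<open>Membership in the \<open>n\<close>-th power of the ideal generated by \<open>g(X)\<close> and \<open>Y - y\<close>.\<close>

definition vanishes_to_order :: "'a::comm_ring_1 \<Rightarrow> 'a poly \<Rightarrow> nat \<Rightarrow> 'a poly poly \<Rightarrow> bool" where
  "vanishes_to_order y g n H \<longleftrightarrow> (\<forall>j. g ^ (n - j) dvd taylor_coeff y j H)"

lemma vanishes_to_order_0: "vanishes_to_order y g 0 H"
  by (simp add: vanishes_to_order_def)

lemma vanishes_to_order_1: "g dvd specialize y H \<Longrightarrow> vanishes_to_order y g 1 H"
  unfolding vanishes_to_order_def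
proof
  fix j assume "g dvd specialize y H"
  then show "g ^ (1 - j) dvd taylor_coeff y j H" by (cases j) auto
qed

lemma vanishes_to_order_mult:
  assumes "vanishes_to_order y g a G" and "vanishes_to_order y g b H"
  shows "vanishes_to_order y g (a + b) (G * H)"
  unfolding vanishes_to_order_def taylor_coeff_mult
proof (intro allI dvd_sum)
  fix j i :: nat assume "i \<in> {..j}"
  \<comment> \<open>Truncated subtraction can only enlarge the exponent on the right.\<close>
  then have "g ^ (a + b - j) dvd g ^ (a - i) * g ^ (b - (j - i))"
    unfolding power_add[symmetric] by (intro le_imp_power_dvd) auto
  also have "\<dots> dvd taylor_coeff y i G * taylor_coeff y (j - i) H"
    using assms by (intro mult_dvd_mono) (auto simp: vanishes_to_order_def)
  finally show "g ^ (a + b - j) dvd taylor_coeff y i G * taylor_coeff y (j - i) H" .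
qed

lemma vanishes_to_order_prod:
  assumes "finite A" and "\<And>u. u \<in> A \<Longrightarrow> vanishes_to_order y g (m u) (F u)"
  shows "vanishes_to_order y g (\<Sum>u\<in>A. m u) (prod F A)"
  using assms by (induction A rule: finite_induct) (auto intro: vanishes_to_order_0 vanishes_to_order_mult)

lemma vanishes_to_order_vanishing_poly:
  assumes "\<And>x. vanishes_to_order y [:- x, 1:] n H"
  shows "vanishes_to_order y vanishing_poly n H"
  unfolding vanishes_to_order_def vanishing_poly_def
  by (intro allI prod_linear_powers_dvd) (use assms in \<open>auto simp: vanishes_to_order_def\<close>)

section \<open>Expansion in powers of Z\<close>

text \<open>Division of H by Z leaves a remainder C0 whose low Taylor coefficients at each y in N
  are divisible by Z and of degree below p, hence zero. So each nonzero coefficient of C0 has large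
  degree in Y, which by the total degree bounds its index in X. The quotient satisfies the
  hypotheses for the next smaller n.\<close>

lemma vanishing_expansion:
  fixes H :: "'a::{field,finite} poly poly"
  assumes N: "card N + d = CARD('a)"
    and "total_degree_le (n * CARD('a)) H"
    and "\<And>y. y \<in> N \<Longrightarrow> vanishes_to_order y vanishing_poly n H"
  shows "\<exists>c. specialize z H = (\<Sum>a\<le>n. vanishing_poly ^ a * c a) \<and> (\<forall>a\<le>n. degree (c a) \<le> (n - a) * d)"
  using assms(2,3)
proof (induction n arbitrary: H)
  case 0
  have "coeff H i = 0" if "0 < i" for i using 0(1) that by (auto simp: total_degree_le_def)
  then have "degree (specialize z H) \<le> 0" by (intro degree_le) (simp add: coeff_specialize)
  then show ?case by (intro exI[of _ "\<lambda>_. specialize z H"]) auto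
next
  case (Suc n)
  let ?p = "CARD('a)" and ?Z = "vanishing_poly :: 'a poly"
  \<comment> \<open>Z(X) as a bivariate polynomial, constant in Y.\<close>
  define ZZ where "ZZ = map_poly (\<lambda>c. [:c:]) ?Z"
  have cZZ: "coeff ZZ i = [:coeff ?Z i:]" for i by (simp add: ZZ_def coeff_map_poly)
  have degZZ: "degree ZZ = ?p" unfolding ZZ_def degree_vanishing_poly[symmetric]
    by (rule degree_map_poly) auto
  have "lead_coeff ?Z = 1" unfolding vanishing_poly_def by (rule lead_coeff_prod_linear)
  then have leadZZ: "lead_coeff ZZ = 1" by (simp add: degZZ cZZ degree_vanishing_poly one_pCons)
  have tdZZ: "total_degree_le ?p ZZ"
    unfolding total_degree_le_def cZZ using degree_vanishing_poly[where 'a = 'a] le_degree[of ?Z] by auto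
  have le: "?p \<le> Suc n * ?p" by simp
  obtain H1 C0 where div: "H = ZZ * H1 + C0" "total_degree_le (Suc n * ?p - ?p) H1"
      "total_degree_le (Suc n * ?p) C0" "\<And>i. ?p \<le> i \<Longrightarrow> coeff C0 i = 0"
    using total_degree_le_monic_division[OF degZZ leadZZ tdZZ Suc.prems(1) le] by blast
  have "taylor_coeff y j ZZ = (if j = 0 then ?Z else 0)" for y j
    by (rule poly_eqI) (auto simp: coeff_taylor_coeff cZZ coeff_pCons split: nat.split)
  then have "taylor_coeff y j (ZZ * H1) = (\<Sum>i\<le>j. if i = 0 then ?Z * taylor_coeff y j H1 else 0)" for y j
    unfolding taylor_coeff_mult by (intro sum.cong) auto
  then have tay: "taylor_coeff y j H = ?Z * taylor_coeff y j H1 + taylor_coeff y j C0" for y j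
    unfolding div(1) taylor_coeff_add by simp
  have C0: "taylor_coeff y j C0 = 0" if "y \<in> N" "j < Suc n" for y j
  proof -
    have "?Z ^ 1 dvd ?Z ^ (Suc n - j)" using that(2) by (intro le_imp_power_dvd) auto
    also have "\<dots> dvd taylor_coeff y j H"
      using Suc.prems(2)[OF that(1)] by (simp add: vanishes_to_order_def)
    finally have Z: "?Z dvd taylor_coeff y j C0" unfolding tay by (simp add: dvd_add_right_iff)
    show ?thesis
    proof (rule ccontr)
      assume nz: "taylor_coeff y j C0 \<noteq> 0"
      then have "?p \<le> degree (taylor_coeff y j C0)"
        using dvd_imp_degree_le[OF Z] by (simp add: degree_vanishing_poly)
      then have "lead_coeff (taylor_coeff y j C0) = 0"
        by (subst coeff_taylor_coeff) (simp add: div(4))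
      then show False using nz by simp
    qed
  qed
  have "vanishes_to_order y ?Z n H1" if "y \<in> N" for y
    unfolding vanishes_to_order_def
  proof
    fix j
    show "?Z ^ (n - j) dvd taylor_coeff y j H1"
    proof (cases "j < n")
      case True
      then have "?Z * ?Z ^ (n - j) dvd ?Z * taylor_coeff y j H1"
        using Suc.prems(2)[OF that] C0[OF that, of j] tay[of y j]
        unfolding vanishes_to_order_def by (metis Suc_diff_le add.right_neutral less_SucI less_imp_le power_Suc)
      then show ?thesis using vanishing_poly_nonzero[where 'a = 'a] by (simp add: dvd_mult_cancel_left)
    qed auto
  qed
  moreover have "total_degree_le (n * ?p) H1" using div(2) by simp
  ultimately obtain c where c: "specialize z H1 = (\<Sum>a\<le>n. ?Z ^ a * c a)"
      "\<And>a. a \<le> n \<Longrightarrow> degree (c a) \<le> (n - a) * d"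
    using Suc.IH[of H1] by blast
  \<comment> \<open>The remainder becomes the coefficient of Z^0, and the coefficients of the
    quotient move up by one.\<close>
  define c' where "c' = case_nat (specialize z C0) c"
  have "specialize z H = (\<Sum>a\<le>Suc n. ?Z ^ a * c' a)"
    unfolding sum.atMost_Suc_shift tay c by (simp add: c'_def sum_distrib_left mult.assoc)
  moreover have "degree (specialize z C0) \<le> Suc n * d"
  proof (intro degree_le allI impI)
    fix i assume i: "Suc n * d < i"
    have "coeff C0 i = 0"
    proof (rule ccontr)
      assume nz: "coeff C0 i \<noteq> 0"
      \<comment> \<open>The coefficient of X^i is divisible by (Y - y)^(n+1) for p - d values of y,
        so it has degree at least (n + 1)(p - d); total degree (n + 1) p then leaves i \<le> (n + 1)
        d.\<close>
      have "[:- y, 1:] ^ Suc n dvd coeff C0 i" if "y \<in> N" for y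
        using C0[OF that] by (intro coeff_shift_zero_imp_dvd) (metis coeff_0 coeff_taylor_coeff)
      then have "(\<Prod>y\<in>N. [:- y, 1:]) ^ Suc n dvd coeff C0 i"
        by (intro prod_linear_powers_dvd) auto
      then have "degree ((\<Prod>y\<in>N. [:- y, 1:]) ^ Suc n) \<le> degree (coeff C0 i)"
        using nz by (rule dvd_imp_degree_le)
      then have "Suc n * card N \<le> degree (coeff C0 i)"
        using degree_prod_linear[of "\<lambda>y. y" N] by (simp add: degree_power_eq prod_linear_nonzero del: power_Suc)
      moreover have "degree (coeff C0 i) + i \<le> Suc n * ?p"
        using div(3) nz by (simp add: total_degree_le_def)
      moreover have "Suc n * ?p = Suc n * card N + Suc n * d"
        unfolding N[symmetric] by (rule add_mult_distrib2)
      ultimately show False using i by linarith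
    qed
    then show "coeff (specialize z C0) i = 0" by (simp add: coeff_specialize)
  qed
  ultimately show ?case using c(2)
    by (intro exI[of _ c']) (auto simp: c'_def split: nat.split)
qed

section \<open>The Redei polynomial and its cofactor\<close>

text \<open>
  Specialised at \<open>Y = m\<close>, the root belonging to the point \<open>(u, v)\<close> is \<open>v - m u\<close>, which determines the
  line of slope \<open>m\<close> through it.
\<close>

definition redei_poly :: "('a::comm_ring_1 \<times> 'a) set \<Rightarrow> 'a poly poly" where
  "redei_poly U = (\<Prod>u\<in>U. [:[:- snd u, fst u:], 1:])"

lemma specialize_redei_poly:
  "specialize y (redei_poly U) = (\<Prod>u\<in>U. [:- (snd u - y * fst u), 1:])"
proof -
  have "specialize y [:[:- b, a:], 1:] = [:- (b - y * a), 1:]" for a b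
    by (rule poly_eqI) (auto simp: coeff_specialize coeff_pCons algebra_simps split: nat.split)
  then show ?thesis unfolding redei_poly_def specialize_prod by simp
qed

text \<open>Division of Z^n by R in X. For y in N the specialized R divides Z^n, hence the
  specialized remainder, which has smaller degree and so vanishes. For every y the remainder lies
  below X^(n p) and leaves the top coefficient alone.\<close>

lemma redei_poly_cofactor:
  fixes U :: "('a::{field,finite} \<times> 'a) set"
  assumes card: "card U + r = n * CARD('a)"
    and N: "\<And>y x. y \<in> N \<Longrightarrow> card {u\<in>U. snd u - y * fst u = x} \<le> n"
  obtains f where "total_degree_le r f" "total_degree_le (n * CARD('a)) (redei_poly U * f)"
    "\<And>y. y \<in> N \<Longrightarrow> specialize y (redei_poly U) * specialize y f = vanishing_poly ^ n"
    "\<And>y. coeff (specialize y (redei_poly U * f)) (n * CARD('a)) = 1"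
proof -
  let ?p = "CARD('a)" and ?Z = "vanishing_poly :: 'a poly" and ?R = "redei_poly U"
  define G where "G = map_poly (\<lambda>c. [:c:]) (?Z ^ n)"
  have cG: "coeff G i = [:coeff (?Z ^ n) i:]" for i by (simp add: G_def coeff_map_poly)
  have degZn: "degree (?Z ^ n) = n * ?p"
    by (simp add: degree_power_eq vanishing_poly_nonzero degree_vanishing_poly)
  have "lead_coeff ?Z = 1" unfolding vanishing_poly_def by (rule lead_coeff_prod_linear)
  then have leadZn: "coeff (?Z ^ n) (n * ?p) = 1" using degZn lead_coeff_power[of ?Z n] by simp
  have tdG: "total_degree_le (n * ?p) G"
    unfolding total_degree_le_def cG using degZn le_degree[of "?Z ^ n"] by auto
  have spG: "specialize y G = ?Z ^ n" for y
    by (rule poly_eqI) (simp add: coeff_specialize cG)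
  have spR: "degree (specialize y ?R) = card U" for y
    unfolding specialize_redei_poly by (rule degree_prod_linear)
  have R: "degree ?R = card U" "lead_coeff ?R = 1"
    unfolding redei_poly_def lead_coeff_prod by (simp_all add: degree_prod_eq_sum_degree)
  have tdR: "total_degree_le (card U) ?R"
    unfolding redei_poly_def
    by (intro total_degree_le_prod) (auto simp: total_degree_le_def coeff_pCons split: nat.splits)
  have le: "card U \<le> n * ?p" using card by simp
  obtain f s where f: "G = ?R * f + s" "total_degree_le (n * ?p - card U) f" "total_degree_le (n * ?p) s"
      "\<And>i. card U \<le> i \<Longrightarrow> coeff s i = 0"
    using total_degree_le_monic_division[OF R tdR tdG le] by blast
  have tdf: "total_degree_le r f" using f(2) card by (metis add_diff_cancel_left')
  have "total_degree_le (n * ?p) (?R * f)" using total_degree_le_mult[OF tdR tdf] card by simp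
  moreover have "specialize y ?R * specialize y f = ?Z ^ n" if y: "y \<in> N" for y
  proof -
    have eq: "?Z ^ n = specialize y ?R * specialize y f + specialize y s"
      unfolding spG[of y, symmetric] f(1) taylor_coeff_add specialize_mult ..
    have "specialize y ?R dvd ?Z ^ n"
      unfolding specialize_redei_poly by (intro prod_linear_dvd_power N[OF y]) auto
    then have dvd: "specialize y ?R dvd specialize y s" unfolding eq by (simp add: dvd_add_right_iff)
    have "specialize y s = 0"
    proof (rule ccontr)
      assume nz: "specialize y s \<noteq> 0"
      then have "card U \<le> degree (specialize y s)" using dvd_imp_degree_le[OF dvd] spR by simp
      then have "lead_coeff (specialize y s) = 0" by (subst coeff_specialize) (simp add: f(4))
      then show False using nz by simp
    qed
    then show ?thesis using eq by simp
  qed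
  moreover have "coeff (specialize y (?R * f)) (n * ?p) = 1" for y
  proof -
    have "coeff G (n * ?p) = coeff (?R * f) (n * ?p)" using f(4)[OF le] by (simp add: f(1))
    then have "coeff (?R * f) (n * ?p) = [:1:]" by (simp add: cG leadZn)
    then show ?thesis by (simp add: coeff_specialize)
  qed
  ultimately show ?thesis using that tdf by blast
qed

section \<open>Counting points on lines\<close>

text \<open>The lines of direction e are the fibres of \<open>dir_coord e\<close>; see
  \<open>lines_with_slope_eq\<close>.\<close>

fun dir_coord :: "'a::field direction \<Rightarrow> 'a \<times> 'a \<Rightarrow> 'a" where
  "dir_coord (Slope m) u = snd u - m * fst u"
| "dir_coord Vertical u = fst u"

text \<open>A line is specified by a direction and any of its points q, which may or may not belong
  to U.\<close>

definition line_count :: "('a::field \<times> 'a) set \<Rightarrow> 'a direction \<Rightarrow> 'a \<times> 'a \<Rightarrow> nat" where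
  "line_count U e q = card {u\<in>U. dir_coord e u = dir_coord e q}"

definition near_uniform :: "('a::field \<times> 'a) set \<Rightarrow> nat \<Rightarrow> 'a direction set \<Rightarrow> bool" where
  "near_uniform U n E \<longleftrightarrow> (\<forall>e q. e \<notin> E \<longrightarrow> line_count U e q \<le> n \<and> n \<le> line_count U e q + 1)"

lemma UNIV_direction: "(UNIV :: 'a direction set) = insert Vertical (range Slope)"
  by (auto intro: direction.exhaust)

lemma finite_direction: "finite (A :: 'a::finite direction set)"
  by (rule finite_subset[OF subset_UNIV]) (simp add: UNIV_direction)

lemma card_UNIV_direction: "card (UNIV :: 'a::finite direction set) = Suc CARD('a)"
  unfolding UNIV_direction by (subst card_insert_disjoint) (auto simp: card_image inj_def)

lemma ex1_common_direction:
  assumes "u \<noteq> v"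
  shows "\<exists>!e. dir_coord e u = dir_coord e v"
proof (cases "fst u = fst v")
  case True
  show ?thesis
  proof (intro ex1I[of _ Vertical])
    fix e assume "dir_coord e u = dir_coord e v"
    then show "e = Vertical" using True assms by (cases e) (auto simp: prod_eq_iff)
  qed (use True in simp)
next
  case False
  define k where "k = (snd u - snd v) / (fst u - fst v)"
  have k: "k * (fst u - fst v) = snd u - snd v" using False by (simp add: k_def)
  show ?thesis
  proof (intro ex1I[of _ "Slope k"])
    show "dir_coord (Slope k) u = dir_coord (Slope k) v" using k by (simp add: algebra_simps)
  next
    fix e assume e: "dir_coord e u = dir_coord e v"
    show "e = Slope k"
    proof (cases e)
      case (Slope m)
      then have "m * (fst u - fst v) = snd u - snd v" using e by (simp add: algebra_simps)
      then have "m * (fst u - fst v) = k * (fst u - fst v)" using k by simp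
      then show ?thesis using Slope False by simp
    qed (use e False in simp)
  qed
qed

lemma ex1_line_intersection:
  assumes "e \<noteq> l"
  shows "\<exists>!w. dir_coord e w = a \<and> dir_coord l w = b"
proof -
  have slopes: "\<exists>w. dir_coord (Slope m) w = s \<and> dir_coord (Slope k) w = t" if "m \<noteq> k" for m k s t :: 'a
  proof (intro exI)
    define x where "x = (s - t) / (k - m)"
    have "x * (k - m) = s - t" using that by (simp add: x_def)
    then show "dir_coord (Slope m) (x, s + m * x) = s \<and> dir_coord (Slope k) (x, s + m * x) = t"
      by (simp add: algebra_simps)
  qed
  have vert: "\<exists>w. dir_coord (Slope m) w = s \<and> dir_coord Vertical w = t" for m s t :: 'a
    by (intro exI[of _ "(t, s + m * t)"]) simp
  have "\<exists>w. dir_coord e w = a \<and> dir_coord l w = b"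
  proof (cases e)
    case e: (Slope m)
    show ?thesis using assms slopes vert by (cases l) (auto simp only: e)
  next
    case e: Vertical
    obtain m where "l = Slope m" using assms e by (cases l) auto
    then show ?thesis using vert[of m b a] by (auto simp only: e)
  qed
  moreover have "w = w'" if "dir_coord e w = a \<and> dir_coord l w = b" "dir_coord e w' = a \<and> dir_coord l w' = b" for w w'
  proof (rule ccontr)
    assume "w \<noteq> w'"
    from ex1_common_direction[OF this] show False using assms that by auto
  qed
  ultimately show ?thesis by blast
qed

text \<open>The lines through q partition the remaining points of the plane.\<close>

lemma sum_line_count:
  fixes U :: "('a::{field,finite} \<times> 'a) set"
  assumes "q \<notin> U"
  shows "(\<Sum>e\<in>UNIV. line_count U e q) = card U"
proof -
  have "card U = card (\<Union>e\<in>UNIV. {u\<in>U. dir_coord e u = dir_coord e q})"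
  proof (rule arg_cong[of _ _ card])
    show "U = (\<Union>e\<in>UNIV. {u\<in>U. dir_coord e u = dir_coord e q})"
      using ex1_common_direction[of _ q] assms by fastforce
  qed
  also have "\<dots> = (\<Sum>e\<in>UNIV. card {u\<in>U. dir_coord e u = dir_coord e q})"
  proof (rule card_UN_disjoint)
    show "\<forall>e\<in>UNIV. \<forall>e'\<in>UNIV. e \<noteq> e' \<longrightarrow>
        {u\<in>U. dir_coord e u = dir_coord e q} \<inter> {u\<in>U. dir_coord e' u = dir_coord e' q} = {}"
    proof (intro ballI impI equals0I)
      fix e e' u
      assume "e \<noteq> e'" "u \<in> {u\<in>U. dir_coord e u = dir_coord e q} \<inter> {u\<in>U. dir_coord e' u = dir_coord e' q}"
      then show False using ex1_common_direction[of u q] assms by auto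
    qed
  qed (auto simp: finite_direction)
  finally show ?thesis by (simp add: line_count_def)
qed

lemma card_nonvertical_complement:
  fixes E :: "'a::finite direction set"
  assumes "Vertical \<in> E" and "card E = Suc d"
  shows "card {y. Slope y \<notin> E} + d = CARD('a)"
proof -
  have "E = insert Vertical (Slope ` {y. Slope y \<in> E})"
  proof (intro equalityI subsetI)
    fix e assume "e \<in> E"
    then show "e \<in> insert Vertical (Slope ` {y. Slope y \<in> E})" by (cases e) auto
  qed (use assms(1) in auto)
  then have "card E = card (insert Vertical (Slope ` {y. Slope y \<in> E}))" by simp
  also have "\<dots> = Suc (card {y. Slope y \<in> E})"
    by (subst card_insert_disjoint) (auto simp: card_image inj_on_def)
  finally have "card {y. Slope y \<in> E} = d" using assms(2) by simp
  moreover have "card {y. Slope y \<notin> E} = CARD('a) - card {y. Slope y \<in> E}"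
    by (subst card_Diff_subset[symmetric]) (auto intro: arg_cong[of _ _ card])
  moreover have "card {y. Slope y \<in> E} \<le> CARD('a)" by (rule card_mono) auto
  ultimately show ?thesis by simp
qed

lemma degree_specialize_le: "total_degree_le r f \<Longrightarrow> degree (specialize y f) \<le> r"
proof (intro degree_le allI impI)
  fix i assume "total_degree_le r f" "r < i"
  then have "coeff f i = 0" by (auto simp: total_degree_le_def)
  then show "coeff (specialize y f) i = 0" by (simp add: coeff_specialize)
qed

lemma line_count_Slope: "line_count U (Slope y) q = card {u\<in>U. snd u - y * fst u = dir_coord (Slope y) q}"
  by (simp add: line_count_def)

section \<open>Line counts as root multiplicities\<close>

text \<open>Every element is a root of Z^n of order n, so the order of f measures how many points
  the line lacks.\<close>

lemma line_count_add_order: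
  fixes U :: "('a::{field,finite} \<times> 'a) set"
  assumes "specialize y (redei_poly U) * specialize y f = vanishing_poly ^ n"
  shows "line_count U (Slope y) q + order (dir_coord (Slope y) q) (specialize y f) = n"
proof -
  let ?x = "dir_coord (Slope y) q"
  have "order ?x (specialize y (redei_poly U)) = line_count U (Slope y) q"
    unfolding specialize_redei_poly line_count_Slope by (rule order_prod_linear) simp
  moreover have "order ?x (specialize y (redei_poly U) * specialize y f) =
      order ?x (specialize y (redei_poly U)) + order ?x (specialize y f)"
    using vanishing_poly_nonzero[where 'a = 'a] by (intro order_mult) (simp add: assms)
  ultimately show ?thesis by (simp add: assms order_vanishing_poly_power)
qed

lemma redei_cofactor_near_uniform:
  fixes U :: "('a::{field,finite} \<times> 'a) set"
  assumes card: "card U + r = n * CARD('a)" and unif: "near_uniform U n E"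
  obtains f where "total_degree_le r f" "total_degree_le (n * CARD('a)) (redei_poly U * f)"
    "\<And>y. Slope y \<notin> E \<Longrightarrow> specialize y (redei_poly U) * specialize y f = vanishing_poly ^ n"
    "\<And>y. coeff (specialize y (redei_poly U * f)) (n * CARD('a)) = 1"
proof (rule redei_poly_cofactor[OF card, of "{y. Slope y \<notin> E}"])
  fix x y :: 'a assume "y \<in> {y. Slope y \<notin> E}"
  then have "line_count U (Slope y) (0, x) \<le> n" using unif by (auto simp: near_uniform_def)
  then show "card {u\<in>U. snd u - y * fst u = x} \<le> n" by (simp add: line_count_Slope)
qed (use that in simp)

text \<open>If c points of U lie on the line, c factors of R vanish at (x, y). At most one order is
  missing, and then f(x, y) = 0 supplies it. A larger deficit could not be made up this way: a
  multiple root of f(X, y) need not be a multiple zero in both variables.\<close>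

lemma redei_product_vanishes:
  fixes U :: "('a::{field,finite} \<times> 'a) set"
  assumes "near_uniform U n E" and "Slope y \<notin> E"
    and "specialize y (redei_poly U) * specialize y f = vanishing_poly ^ n"
  shows "vanishes_to_order y vanishing_poly n (redei_poly U * f)"
proof (rule vanishes_to_order_vanishing_poly)
  fix x :: 'a
  let ?L = "[:- x, 1:]"
  define c where "c = line_count U (Slope y) (0, x)"
  have "vanishes_to_order y ?L (\<Sum>u\<in>U. if snd u - y * fst u = x then 1 else 0) (redei_poly U)"
    unfolding redei_poly_def
  proof (rule vanishes_to_order_prod)
    fix u
    show "vanishes_to_order y ?L (if snd u - y * fst u = x then 1 else 0) [:[:- snd u, fst u:], 1:]"
    proof (cases "snd u - y * fst u = x")
      case True
      have "specialize y (redei_poly {u}) = ?L" using specialize_redei_poly[of y "{u}"] True by simp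
      then show ?thesis using True vanishes_to_order_1[of ?L y "[:[:- snd u, fst u:], 1:]"]
        by (simp add: redei_poly_def)
    qed (auto simp: vanishes_to_order_0)
  qed simp
  then have R: "vanishes_to_order y ?L c (redei_poly U)"
    by (simp add: c_def line_count_def sum.If_cases Int_def)
  have c: "c \<le> n" "n \<le> c + 1" using assms(1,2) by (auto simp: near_uniform_def c_def)
  have ord: "c + order x (specialize y f) = n"
    using line_count_add_order[OF assms(3), of "(0, x)"] by (simp add: c_def)
  have "vanishes_to_order y ?L (n - c) f"
  proof (cases "c = n")
    case False
    then have "?L dvd specialize y f" using ord by (metis add.right_neutral order_root poly_eq_0_iff_dvd)
    moreover have "n - c = 1" using c False by simp
    ultimately show ?thesis using vanishes_to_order_1 by metis
  qed (simp add: vanishes_to_order_0)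
  then have "vanishes_to_order y ?L (c + (n - c)) (redei_poly U * f)" using R by (rule vanishes_to_order_mult[rotated])
  then show "vanishes_to_order y ?L n (redei_poly U * f)" using c by simp
qed

text \<open>Amplifies more than n points to at least p - r \<ge> (n + 1) d > n d. The slope z may
  lie in E, since the expansion in powers of Z holds at every z.\<close>

lemma rich_line_has_many_points:
  fixes U :: "('a::{field,finite} \<times> 'a) set"
  assumes prime: "prime CARD('a)" and n: "1 \<le> n" and d: "1 \<le> d"
    and bound: "(n + 1) * d + r \<le> CARD('a)" and card: "card U + r = n * CARD('a)"
    and E: "Vertical \<in> E" "card E = Suc d" and unif: "near_uniform U n E"
    and rich: "n < line_count U (Slope z) q"
  shows "n * d < line_count U (Slope z) q"
proof -
  let ?p = "CARD('a)" and ?Z = "vanishing_poly :: 'a poly"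
  obtain f where f: "total_degree_le r f" "total_degree_le (n * ?p) (redei_poly U * f)"
    "\<And>y. Slope y \<notin> E \<Longrightarrow> specialize y (redei_poly U) * specialize y f = ?Z ^ n"
    "\<And>y. coeff (specialize y (redei_poly U * f)) (n * ?p) = 1"
    using redei_cofactor_near_uniform[OF card unif] by blast
  have "\<And>y. y \<in> {y. Slope y \<notin> E} \<Longrightarrow> vanishes_to_order y ?Z n (redei_poly U * f)"
    using redei_product_vanishes[OF unif] f(3) by simp
  from vanishing_expansion[OF card_nonvertical_complement[OF E] f(2) this, of z]
  obtain c where c: "specialize z (redei_poly U * f) = (\<Sum>a\<le>n. ?Z ^ a * c a)"
    "\<And>a. a \<le> n \<Longrightarrow> degree (c a) \<le> (n - a) * d" by auto
  have "d < (n + 1) * d" using n d by simp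
  then have dp: "d < ?p" using bound by linarith
  \<comment> \<open>The coefficient of X^(n p) is compared: as d < p, the terms with a < n have
    smaller degree.\<close>
  have cn: "c n = 1"
  proof -
    obtain t where t: "c n = [:t:]" using c(2)[of n] by (auto elim: degree_eq_zeroE)
    have "coeff (?Z ^ a * c a) (n * ?p) = 0" if "a < n" for a
    proof (rule coeff_eq_0)
      have "degree (?Z ^ a * c a) \<le> a * ?p + (n - a) * d"
        using degree_mult_le[of "?Z ^ a" "c a"] c(2)[of a] that
        by (simp add: degree_power_eq vanishing_poly_nonzero degree_vanishing_poly)
      also have "\<dots> < a * ?p + (n - a) * ?p" using dp that by simp
      also have "\<dots> = n * ?p" using that by (simp add: add_mult_distrib[symmetric])
      finally show "degree (?Z ^ a * c a) < n * ?p" .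
    qed
    then have "coeff (\<Sum>a\<le>n. ?Z ^ a * c a) (n * ?p) = coeff (?Z ^ n * c n) (n * ?p)"
      by (simp add: coeff_sum lessThan_Suc_atMost[symmetric])
    also have "\<dots> = t"
    proof -
      have "lead_coeff ?Z = 1" unfolding vanishing_poly_def by (rule lead_coeff_prod_linear)
      then have "lead_coeff (?Z ^ n) = 1" by (simp only: lead_coeff_power power_one)
      moreover have "degree (?Z ^ n) = n * ?p"
        by (simp add: degree_power_eq vanishing_poly_nonzero degree_vanishing_poly)
      ultimately show ?thesis by (simp add: t)
    qed
    finally show ?thesis using f(4)[of z] by (simp add: c(1) t one_pCons)
  qed
  have "(\<Prod>u\<in>U. [:- (snd u - z * fst u), 1:]) * specialize z f = (\<Sum>a\<le>n. ?Z ^ a * c a)"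
    using c(1) by (simp add: specialize_mult specialize_redei_poly)
  from order_ge_of_lacunary[OF prime n d bound finite card degree_specialize_le[OF f(1)] this cn c(2)]
  have "?p \<le> line_count U (Slope z) q + r" using rich unfolding line_count_Slope by blast
  then show ?thesis using bound d by simp
qed

text \<open>\<open>\<phi>\<close> restricts f to the line X = v - u Y dual to q = (u, v). For slopes
  outside E its zeros are those whose line through q has fewer than n points. The many points on one
  line through q force more zeros than the degree permits.\<close>

lemma missing_point_vertical:
  fixes U :: "('a::{field,finite} \<times> 'a) set"
  assumes card: "card U + r = n * CARD('a)"
    and E: "Vertical \<in> E" "card E = Suc d" and unif: "near_uniform U n E"
    and q: "q \<notin> U" and l: "l \<in> E" and many: "n * d < line_count U l q"
  shows "(\<forall>e. e \<notin> E \<longrightarrow> line_count U e q < n) \<and> 1 \<le> r"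
proof -
  let ?p = "CARD('a)" and ?Z = "vanishing_poly :: 'a poly"
  obtain f where f: "total_degree_le r f"
    "\<And>y. Slope y \<notin> E \<Longrightarrow> specialize y (redei_poly U) * specialize y f = ?Z ^ n"
    using redei_cofactor_near_uniform[OF card unif] by blast
  define N where "N = {y. Slope y \<notin> E}"
  define S where "S = {y\<in>N. line_count U (Slope y) q < n}"
  define \<phi> where "\<phi> = poly f [:snd q, - fst q:]"
  have ord: "line_count U (Slope y) q + order (dir_coord (Slope y) q) (specialize y f) = n" if "y \<in> N" for y
    using that by (intro line_count_add_order f(2)) (simp add: N_def)
  have nz: "specialize y f \<noteq> 0" if "y \<in> N" for y
    using f(2)[of y] that vanishing_poly_nonzero[where 'a = 'a] by (force simp: N_def)
  have phi: "poly \<phi> y = poly (specialize y f) (dir_coord (Slope y) q)" for y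
    using poly_specialize[of y f "[:snd q, - fst q:]"] by (simp add: \<phi>_def mult.commute)
  \<comment> \<open>The p - d slopes in N would need n p - n d points on their lines through q. At
    most n p - r minus the more than n d points in direction l are available, and each slope can be
    short by only one.\<close>
  have "r < card S"
  proof -
    have "(\<Sum>y\<in>N. line_count U (Slope y) q) = (\<Sum>e\<in>Slope ` N. line_count U e q)"
      by (subst sum.reindex) (auto simp: inj_on_def)
    then have "(\<Sum>y\<in>N. line_count U (Slope y) q) + line_count U l q = (\<Sum>e\<in>insert l (Slope ` N). line_count U e q)"
      using l by (subst sum.insert) (auto simp: N_def)
    also have "\<dots> \<le> card U"
      unfolding sum_line_count[OF q, symmetric] by (rule sum_mono2) (auto simp: finite_direction)
    finally have upper: "(\<Sum>y\<in>N. line_count U (Slope y) q) + line_count U l q \<le> card U" .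
    have "n * card N = (\<Sum>y\<in>N. n)" by simp
    also have "\<dots> \<le> (\<Sum>y\<in>N. line_count U (Slope y) q + (if y \<in> S then 1 else 0))"
    proof (rule sum_mono)
      fix y assume "y \<in> N"
      then have "n \<le> line_count U (Slope y) q + 1"
        using unif unfolding near_uniform_def N_def by blast
      then show "n \<le> line_count U (Slope y) q + (if y \<in> S then 1 else 0)"
        using \<open>y \<in> N\<close> by (simp add: S_def)
    qed
    also have "\<dots> = (\<Sum>y\<in>N. line_count U (Slope y) q) + card S"
      by (simp add: sum.distrib sum.If_cases S_def Int_def conj_commute)
    finally have "n * card N \<le> (\<Sum>y\<in>N. line_count U (Slope y) q) + card S" .
    moreover have "n * card N + n * d = n * ?p"
      using card_nonvertical_complement[OF E] by (simp add: N_def add_mult_distrib2[symmetric])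
    ultimately show ?thesis using upper card many by linarith
  qed
  moreover have "S \<subseteq> {y. poly \<phi> y = 0}"
  proof
    fix y assume "y \<in> S"
    then have "order (dir_coord (Slope y) q) (specialize y f) \<noteq> 0" using ord[of y] by (auto simp: S_def)
    then show "y \<in> {y. poly \<phi> y = 0}" by (simp add: phi order_root)
  qed
  ultimately have "r < card {y. poly \<phi> y = 0}" by (meson card_mono finite le_trans not_le)
  moreover have "degree \<phi> \<le> r" unfolding \<phi>_def by (rule degree_poly_total_degree_le[OF f(1)]) simp
  ultimately have "\<phi> = 0" using card_poly_roots_bound[of \<phi>] by force
  then have "order (dir_coord (Slope y) q) (specialize y f) \<noteq> 0" if "y \<in> N" for y
    using phi[of y] nz[OF that] by (simp add: order_root)
  then have less: "line_count U (Slope y) q < n" if "y \<in> N" for y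
    using ord[OF that] that by fastforce
  obtain y where y: "y \<in> S" using \<open>r < card S\<close> by fastforce
  then have yN: "y \<in> N" by (simp add: S_def)
  have "1 \<le> order (dir_coord (Slope y) q) (specialize y f)" using ord[OF yN] y by (simp add: S_def)
  also have "\<dots> \<le> degree (specialize y f)" by (rule order_degree) (rule nz[OF yN])
  also have "\<dots> \<le> r" by (rule degree_specialize_le[OF f(1)])
  finally have "1 \<le> r" .
  moreover have "line_count U e q < n" if "e \<notin> E" for e
    using that less E(1) by (cases e) (auto simp: N_def)
  ultimately show ?thesis by blast
qed

lemma lines_with_slope_eq: "lines_with_slope e = range (\<lambda>c. {u. dir_coord e u = c})"
proof (cases e)
  case (Slope m)
  have "{(u, v). v = m * u - k} = {u. dir_coord e u = - k}" for k
    by (auto simp: Slope algebra_simps)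
  then have "lines_with_slope e = range (\<lambda>k. {u. dir_coord e u = - k})" using Slope by auto
  also have "\<dots> = range (\<lambda>c. {u. dir_coord e u = c})"
  proof (intro equalityI image_subsetI)
    fix c :: 'a
    show "{u. dir_coord e u = c} \<in> range (\<lambda>k. {u. dir_coord e u = - k})"
      by (rule range_eqI[of _ _ "- c"]) simp
  qed blast
  finally show ?thesis .
next
  case Vertical
  have "{(u, v). u = c} = {u. dir_coord Vertical u = c}" for c by auto
  then show ?thesis using Vertical by auto
qed

lemma is_line_dir_coord: "is_line {u. dir_coord e u = c}"
  unfolding is_line_def lines_with_slope_eq by blast

lemma card_line: "card {u :: 'a::{field,finite} \<times> 'a. dir_coord e u = c} = CARD('a)"
proof (cases e)
  case (Slope m)
  have "{u. dir_coord e u = c} = range (\<lambda>t. (t, c + m * t))"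
    by (auto simp: Slope image_iff algebra_simps)
  then show ?thesis by (simp add: card_image inj_def)
next
  case Vertical
  have "{u. dir_coord e u = c} = range (\<lambda>t. (c, t))" by (auto simp: Vertical)
  then show ?thesis by (simp add: card_image inj_def)
qed

section \<open>Moving a direction to infinity\<close>

lemma direction_to_vertical:
  fixes e0 :: "'a::field direction"
  obtains T :: "'a \<times> 'a \<Rightarrow> 'a \<times> 'a" and \<tau> where "inj T" "bij \<tau>" "\<tau> e0 = Vertical"
    "\<And>e u v. dir_coord (\<tau> e) (T u) = dir_coord (\<tau> e) (T v) \<longleftrightarrow> dir_coord e u = dir_coord e v"
proof (cases e0)
  case (Slope m)
  \<comment> \<open>This linear map takes slope m to vertical, vertical to 0 and any other slope k
    to 1/(k - m); \<open>\<sigma>\<close> below inverts \<open>\<tau>\<close>.\<close>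
  define T where "T = (\<lambda>u :: 'a \<times> 'a. (snd u - m * fst u, fst u))"
  define \<tau> where "\<tau> = (\<lambda>e. case e of Vertical \<Rightarrow> Slope 0
    | Slope k \<Rightarrow> if k = m then Vertical else Slope (1 / (k - m)))"
  define \<sigma> where "\<sigma> = (\<lambda>e. case e of Vertical \<Rightarrow> Slope m
    | Slope k \<Rightarrow> if k = 0 then Vertical else Slope (m + 1 / k))"
  have "inj T" by (auto simp: inj_def T_def prod_eq_iff)
  moreover have "bij \<tau>"
    by (rule o_bij[of \<sigma>]) (auto simp: fun_eq_iff \<tau>_def \<sigma>_def split: direction.split)
  moreover have "\<tau> e0 = Vertical" by (simp add: \<tau>_def Slope)
  moreover have "dir_coord (\<tau> e) (T u) = dir_coord (\<tau> e) (T v) \<longleftrightarrow> dir_coord e u = dir_coord e v" for e u v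
  proof (cases e)
    case e: (Slope k)
    show ?thesis
    proof (cases "k = m")
      case False
      have *: "(k - m) * dir_coord (\<tau> e) (T w) = - dir_coord e w" for w
        using False by (simp add: \<tau>_def T_def e field_simps)
      have "dir_coord (\<tau> e) (T u) = dir_coord (\<tau> e) (T v) \<longleftrightarrow>
          (k - m) * dir_coord (\<tau> e) (T u) = (k - m) * dir_coord (\<tau> e) (T v)" using False by simp
      then show ?thesis by (simp only: * neg_equal_iff_equal)
    qed (simp add: \<tau>_def T_def e)
  qed (simp add: \<tau>_def T_def)
  ultimately show ?thesis by (rule that)
next
  case Vertical
  then show ?thesis by (intro that[of id id]) auto
qed

lemma missing_point:
  fixes U :: "('a::{field,finite} \<times> 'a) set"
  assumes prime: "prime CARD('a)" and n: "1 \<le> n"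
    and bound: "(n + 1) * d + r \<le> CARD('a)" and card: "card U + r = n * CARD('a)"
    and E: "card E = Suc d" and unif: "near_uniform U n E"
    and q: "q \<notin> U" and l: "l \<in> E"
    and cnt: "if d = 0 then 1 \<le> line_count U l q else n < line_count U l q"
  shows "(\<forall>e. e \<notin> E \<longrightarrow> line_count U e q < n) \<and> 1 \<le> r"
proof -
  \<comment> \<open>For d \<ge> 1 the direction sent to infinity differs from l, so that l becomes a
    finite slope and the amplification applies. For d = 0 the threshold n d is 0 and no
    amplification is required.\<close>
  obtain e0 where e0: "e0 \<in> E" "d = 0 \<or> e0 \<noteq> l"
  proof (cases "d = 0")
    case False
    then have "card (E - {l}) \<noteq> 0" using E l by (simp add: finite_direction)
    then have "E - {l} \<noteq> {}" by (intro notI) (simp only: card.empty)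
    then show ?thesis using that by blast
  qed (use l that in auto)
  obtain T :: "'a \<times> 'a \<Rightarrow> 'a \<times> 'a" and \<tau> where T: "inj T" "bij \<tau>" "\<tau> e0 = Vertical"
    "\<And>e u v. dir_coord (\<tau> e) (T u) = dir_coord (\<tau> e) (T v) \<longleftrightarrow> dir_coord e u = dir_coord e v"
    using direction_to_vertical[of e0] by blast
  have lc: "line_count (T ` U) (\<tau> e) (T w) = line_count U e w" for e w
  proof -
    have "{u \<in> T ` U. dir_coord (\<tau> e) u = dir_coord (\<tau> e) (T w)} = T ` {u\<in>U. dir_coord e u = dir_coord e w}"
      using T(4)[of e _ w] by blast
    then show ?thesis using T(1) by (simp add: line_count_def card_image inj_on_subset)
  qed
  have mem: "\<tau> e \<in> \<tau> ` E \<longleftrightarrow> e \<in> E" for e using T(2) by (simp add: bij_is_inj inj_image_mem_iff)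
  have cardU: "card (T ` U) + r = n * CARD('a)" using card T(1) by (simp add: card_image inj_on_subset)
  have E': "Vertical \<in> \<tau> ` E" "card (\<tau> ` E) = Suc d"
    using e0(1) T(3) E card_image[OF inj_on_subset[OF bij_is_inj[OF T(2)] subset_UNIV], of E]
    by (force, simp)
  have surjT: "\<exists>w. v = T w" for v
    using finite_UNIV_inj_surj[OF finite T(1)] by (rule surjD)
  have surj\<tau>: "\<exists>e'. e = \<tau> e'" for e using bij_is_surj[OF T(2)] by (rule surjD)
  have unif': "near_uniform (T ` U) n (\<tau> ` E)"
    unfolding near_uniform_def
  proof (intro allI impI)
    fix e v assume e: "e \<notin> \<tau> ` E"
    obtain e' w where ew: "e = \<tau> e'" "v = T w" using surjT[of v] surj\<tau>[of e] by blast
    then have "e' \<notin> E" using e mem[of e'] by simp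
    then show "line_count (T ` U) e v \<le> n \<and> n \<le> line_count (T ` U) e v + 1"
      using unif[unfolded near_uniform_def, rule_format, of e' w] lc[of e' w] ew by simp
  qed
  have many: "n * d < line_count (T ` U) (\<tau> l) (T q)"
  proof (cases "d = 0")
    case False
    then have "\<tau> l \<noteq> Vertical" using e0(2) T(2,3) by (metis bij_is_inj injD)
    then obtain z where "\<tau> l = Slope z" by (cases "\<tau> l") auto
    then show ?thesis
      using rich_line_has_many_points[OF prime n _ bound cardU E' unif', of z "T q"] False cnt lc[of l q] by simp
  qed (use cnt lc in simp)
  have "T q \<notin> T ` U" using q T(1) by (simp add: inj_image_mem_iff)
  then have *: "(\<forall>e. e \<notin> \<tau> ` E \<longrightarrow> line_count (T ` U) e (T q) < n) \<and> 1 \<le> r"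
    using mem[of l] l many by (intro missing_point_vertical[OF cardU E' unif']) auto
  have "line_count U e q < n" if "e \<notin> E" for e
    using *[THEN conjunct1, rule_format, of "\<tau> e"] mem[of e] lc[of e q] that by simp
  with * show ?thesis by blast
qed

text \<open>Otherwise each of the p + 1 lines through a point of U has at most n - 1 further points,
  which gives n p - r \<le> 1 + (p + 1)(n - 1), that is p \<le> n + r.\<close>

lemma rich_line_exists:
  fixes U :: "('a::{field,finite} \<times> 'a) set"
  assumes "card U + r = n * CARD('a)" and "n + r < CARD('a)" and "1 \<le> n"
  shows "\<exists>l q. n < line_count U l q"
proof (rule ccontr)
  assume neg: "\<not> ?thesis"
  let ?p = "CARD('a)"
  have "?p \<le> n * ?p" using assms(3) by simp
  then have "0 < card U" using assms(1,2) by linarith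
  then have "U \<noteq> {}" by auto
  then obtain q where q: "q \<in> U" by blast
  have "line_count (U - {q}) e q \<le> n - 1" for e
  proof -
    have "{u \<in> U. dir_coord e u = dir_coord e q} = insert q {u \<in> U - {q}. dir_coord e u = dir_coord e q}"
      using q by auto
    then have "line_count U e q = Suc (line_count (U - {q}) e q)" by (simp add: line_count_def)
    moreover have "line_count U e q \<le> n" using neg by (meson not_less)
    ultimately show ?thesis by simp
  qed
  then have "(\<Sum>e\<in>UNIV. line_count (U - {q}) e q) \<le> of_nat (card (UNIV :: 'a direction set)) * (n - 1)"
    by (intro sum_bounded_above)
  then have "card (U - {q}) \<le> Suc ?p * (n - 1)"
    by (simp add: sum_line_count card_UNIV_direction)
  moreover have "card U = Suc (card (U - {q}))" by (rule card.remove[OF finite q])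
  moreover obtain n' where "n = Suc n'" using assms(3) by (cases n) auto
  ultimately show False using assms(1,2) by (simp add: mult.commute)
qed

section \<open>Covering by lines\<close>

text \<open>Induction on n + r with E and d fixed: a full line is removed, lowering n, or a missing
  point of a suitable line is added, lowering r.\<close>

lemma covered_by_lines:
  fixes U :: "('a::{field,finite} \<times> 'a) set"
  assumes prime: "prime CARD('a)" and "(n + 1) * d + r \<le> CARD('a)" and "r < CARD('a)"
    and "card U + r = n * CARD('a)" and E: "card E = Suc d" and "near_uniform U n E"
  shows "\<exists>L. (\<forall>l\<in>L. is_line l) \<and> finite L \<and> card L \<le> n \<and> U \<subseteq> \<Union>L"
  using assms(2-4,6)
proof (induction "n + r" arbitrary: n r U rule: less_induct)
  case less
  let ?p = "CARD('a)"
  note bound = less.prems(1) and r = less.prems(2) and card = less.prems(3) and unif = less.prems(4)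
  show ?case
  proof (cases "n = 0")
    case True
    then have "U = {}" using card by simp
    then show ?thesis by (intro exI[of _ "{}"]) auto
  next
    case False
    then have n: "1 \<le> n" by simp
    obtain l q0 where l: "l \<in> E"
      and cnt: "if d = 0 then 1 \<le> line_count U l q0 else n < line_count U l q0"
    proof (cases "d = 0")
      case True
      obtain l where "l \<in> E" using E by fastforce
      moreover have "?p \<le> n * ?p" using n by simp
      then have "0 < card U" using r card by linarith
      then have "U \<noteq> {}" by auto
      then obtain q0 where "q0 \<in> U" by blast
      then have "0 < line_count U l q0" unfolding line_count_def by (subst card_gt_0_iff) (blast intro: finite)
      ultimately show ?thesis using that[of l q0] True by simp
    next
      case False
      have "n + r < ?p" using bound False by (cases d) auto
      from rich_line_exists[OF card this n] obtain l q where lq: "n < line_count U l q" by blast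
      then have "l \<in> E" using unif[unfolded near_uniform_def, rule_format, of l q] by fastforce
      then show ?thesis using that lq False by simp
    qed
    define M where "M = {u. dir_coord l u = dir_coord l q0}"
    show ?thesis
    proof (cases "M \<subseteq> U")
      case True
      obtain n' where n': "n = Suc n'" using n by (cases n) auto
      have "card M = ?p" unfolding M_def by (rule card_line)
      then have "card (U - M) + ?p = card U"
        using True card_mono[of U M] by (simp add: card_Diff_subset)
      then have card': "card (U - M) + r = n' * ?p" using card by (simp add: n')
      \<comment> \<open>A line in a direction outside E is not parallel to M, so it loses exactly
        one point.\<close>
      have unif': "near_uniform (U - M) n' E"
        unfolding near_uniform_def
      proof (intro allI impI)
        fix e q assume e: "e \<notin> E"
        obtain w where w: "\<And>u. dir_coord e u = dir_coord e q \<and> dir_coord l u = dir_coord l q0 \<longleftrightarrow> u = w"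
          using ex1_line_intersection[of e l "dir_coord e q" "dir_coord l q0"] e l by metis
        have "{u\<in>U. dir_coord e u = dir_coord e q} = insert w {u\<in>U - M. dir_coord e u = dir_coord e q}"
          using True w unfolding M_def by blast
        moreover have "w \<notin> U - M" using w[of w] by (simp add: M_def)
        ultimately have "line_count U e q = Suc (line_count (U - M) e q)" by (simp add: line_count_def)
        moreover have "line_count U e q \<le> n \<and> n \<le> line_count U e q + 1"
          using unif e unfolding near_uniform_def by blast
        ultimately show "line_count (U - M) e q \<le> n' \<and> n' \<le> line_count (U - M) e q + 1" by (simp add: n')
      qed
      have "n' + r < n + r" "(n' + 1) * d + r \<le> ?p" using bound by (simp_all add: n')
      from less.hyps[OF this r card' unif'] obtain L
        where L: "\<forall>l\<in>L. is_line l" "finite L" "card L \<le> n'" "U - M \<subseteq> \<Union>L" by blast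
      have "card (insert M L) \<le> n" using L(2,3) by (simp add: card_insert_if n')
      moreover have "is_line M" unfolding M_def by (rule is_line_dir_coord)
      ultimately show ?thesis using L by (intro exI[of _ "insert M L"]) auto
    next
      case False
      then obtain q where q: "q \<in> M" "q \<notin> U" by blast
      then have "line_count U l q = line_count U l q0" by (simp add: line_count_def M_def)
      with cnt have "if d = 0 then 1 \<le> line_count U l q else n < line_count U l q" by (simp only:)
      from missing_point[OF prime n bound card E unif q(2) l this]
      have miss: "\<And>e. e \<notin> E \<Longrightarrow> line_count U e q < n" "1 \<le> r" by auto
      \<comment> \<open>The lines through q outside E had fewer than n points, so one more is
        admissible.\<close>
      have unif': "near_uniform (insert q U) n E"
        unfolding near_uniform_def
      proof (intro allI impI)
        fix e q' assume e: "e \<notin> E"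
        have u: "line_count U e q' \<le> n \<and> n \<le> line_count U e q' + 1"
          using unif e unfolding near_uniform_def by blast
        show "line_count (insert q U) e q' \<le> n \<and> n \<le> line_count (insert q U) e q' + 1"
        proof (cases "dir_coord e q' = dir_coord e q")
          case True
          then have "{u \<in> insert q U. dir_coord e u = dir_coord e q'} = insert q {u\<in>U. dir_coord e u = dir_coord e q'}"
            by auto
          then have "line_count (insert q U) e q' = Suc (line_count U e q')" using q(2) by (simp add: line_count_def)
          moreover have "line_count U e q' < n" using miss(1)[OF e] True by (simp add: line_count_def)
          ultimately show ?thesis using u by simp
        next
          case False
          then have "{u \<in> insert q U. dir_coord e u = dir_coord e q'} = {u\<in>U. dir_coord e u = dir_coord e q'}"
            by auto
          then show ?thesis using u by (simp add: line_count_def)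
        qed
      qed
      have "n + (r - 1) < n + r" "(n + 1) * d + (r - 1) \<le> ?p" "r - 1 < ?p"
        "card (insert q U) + (r - 1) = n * ?p"
        using miss(2) bound r card q(2) by simp_all
      from less.hyps[OF this unif'] obtain L
        where "\<forall>l\<in>L. is_line l" "finite L" "card L \<le> n" "insert q U \<subseteq> \<Union>L" by blast
      then show ?thesis by (intro exI[of _ L]) auto
    qed
  qed
qed

section \<open>Passage to special directions\<close>

text \<open>Turns at most n lines into exactly n; the p vertical lines show that enough lines
  exist.\<close>

lemma extend_to_n_lines:
  fixes L :: "('a::{field,finite} \<times> 'a) set set"
  assumes "\<forall>l\<in>L. is_line l" and "card L \<le> n" and "n \<le> CARD('a)"
  shows "\<exists>L'. L \<subseteq> L' \<and> (\<forall>l\<in>L'. is_line l) \<and> finite L' \<and> card L' = n"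
proof -
  let ?A = "{l :: ('a \<times> 'a) set. is_line l}"
  have "inj (\<lambda>c::'a. {u. dir_coord Vertical u = c})"
  proof (rule injI)
    fix c c' :: 'a
    assume "{u :: 'a \<times> 'a. dir_coord Vertical u = c} = {u. dir_coord Vertical u = c'}"
    then have "(c, 0) \<in> {u :: 'a \<times> 'a. dir_coord Vertical u = c'}" by (rule subst) simp
    then show "c = c'" by simp
  qed
  then have "CARD('a) = card (lines_with_slope (Vertical :: 'a direction))"
    unfolding lines_with_slope_eq by (simp add: card_image)
  also have "\<dots> \<le> card ?A" unfolding is_line_def by (rule card_mono[OF finite]) blast
  finally have "n \<le> card ?A" using assms(3) by simp
  with exists_subset_between[of L n ?A] assms(1,2) obtain L' where "L \<subseteq> L'" "L' \<subseteq> ?A" "card L' = n"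
    by auto
  then show ?thesis by (intro exI[of _ L']) auto
qed

text \<open>Here n - 1 < \<open>theta U\<close> \<le> n, so the count lies strictly between n - 2
  and n + 1.\<close>

lemma not_special_line_count:
  fixes U :: "('a::{field,finite} \<times> 'a) set"
  assumes "card U + r = n * CARD('a)" and "r < CARD('a)" and "\<not> special U e"
  shows "line_count U e q \<le> n \<and> n \<le> line_count U e q + 1"
proof -
  let ?p = "real CARD('a)"
  let ?l = "{u. dir_coord e u = dir_coord e q}"
  have "?l \<in> lines_with_slope e" unfolding lines_with_slope_eq by blast
  then have "\<not> rich U ?l" "\<not> poor U ?l" using assms(3) by (auto simp: special_def)
  moreover have "card (?l \<inter> U) = line_count U e q"
    unfolding line_count_def by (rule arg_cong[of _ _ card]) auto
  ultimately have "real (line_count U e q) < theta U + 1" "theta U - 1 < real (line_count U e q)"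
    using is_line_dir_coord[of e "dir_coord e q"] by (simp_all add: rich_def poor_def)
  moreover have "real (card U) + real r = real n * ?p"
    using assms(1) by (metis of_nat_add of_nat_mult)
  then have "theta U = real n - real r / ?p"
    unfolding theta_def by (simp add: field_simps)
  moreover have "0 \<le> real r / ?p" "real r / ?p < 1" using assms(2) by simp_all
  ultimately have "real (line_count U e q) < real n + 1" "real n < real (line_count U e q) + 2" by linarith+
  then show ?thesis by linarith
qed

theorem theorem1p3:
  fixes U :: "('a::{field,finite} \<times> 'a) set" and p n r :: nat
  assumes "prime p" and "CARD('a) = p"
    and "1 \<le> n" and "n \<le> p" and "r < p"
    and "int (card U) = int n * int p - int r"
    and "\<not> (\<exists>L. (\<forall>l\<in>L. is_line l) \<and> finite L \<and> card L = n \<and> U \<subseteq> \<Union>L)"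
  shows "int (card {d. special U d})
    \<ge> \<lceil>(real p + real n + 2 - real r) / (real n + 1)\<rceil>"
proof (rule ccontr)
  let ?D = "{d. special U d}"
  assume "\<not> ?thesis"
  then have "real (card ?D) < (real p + real n + 2 - real r) / (real n + 1)"
    by (simp add: not_le less_ceiling_iff)
  then have "real (card ?D) * (real n + 1) < real p + real n + 2 - real r"
    by (simp add: pos_less_divide_eq)
  then have "real (card ?D * (n + 1) + r) < real (p + n + 2)" by (simp add: algebra_simps)
  then have few: "card ?D * (n + 1) + r < p + n + 2" by (simp only: of_nat_less_iff)
  have card: "card U + r = n * CARD('a)"
  proof -
    have "int (card U + r) = int (n * CARD('a))" using assms(2,6) by simp
    then show ?thesis by (simp only: of_nat_eq_iff)
  qed
  \<comment> \<open>With d + 1 special directions, \<open>few\<close> is precisely (n + 1) d + r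
    \<le> p. If there are none, one arbitrary direction is put into E and d = 0.\<close>
  obtain E d where E: "?D \<subseteq> E" "card E = Suc d" "(n + 1) * d + r \<le> p"
  proof (cases "card ?D")
    case 0
    then have "?D \<subseteq> {Vertical}" by (simp add: finite_direction)
    then show ?thesis using that[of "{Vertical}" 0] assms(5) by simp
  next
    case (Suc d)
    then show ?thesis using that[of ?D d] few by (simp add: algebra_simps)
  qed
  have "near_uniform U n E"
    unfolding near_uniform_def using E(1) not_special_line_count[OF card] assms(2,5) by blast
  then obtain L where L: "\<forall>l\<in>L. is_line l" "card L \<le> n" "U \<subseteq> \<Union>L"
    using covered_by_lines[of n d r U E] E card assms(1,2,5) by auto
  obtain L' where L': "L \<subseteq> L'" "\<forall>l\<in>L'. is_line l" "finite L'" "card L' = n"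
    using extend_to_n_lines[OF L(1,2)] assms(2,4) by auto
  have "U \<subseteq> \<Union>L'" using L(3) Union_mono[OF L'(1)] by (rule subset_trans)
  with L' have "\<exists>L. (\<forall>l\<in>L. is_line l) \<and> finite L \<and> card L = n \<and> U \<subseteq> \<Union>L"
    by (intro exI[of _ L']) simp
  with assms(7) show False by (rule notE)
qed

end
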